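(* Consider the Cauchy problem $$u_{tt}-\Delta u+b(t)u_t-g(t)\Delta u_t=0,\quad (t,x)\in(0,\infty)\times\mathbb{R}^n,\qquad u(0,x)=u_0(x),\quad u_t(0,x)=u_1(x),\quad x\in\mathbb{R}^n.$$ Assume that for all $t\in[0,\infty)$ the coefficient $g$ satisfies: (A1) $g(t)>0$ and $g'(t)>0$; (A2) $1/g\in L^1([0,\infty))$; (A3) $|d_t^k g(t)|\le C_k\, g(t)\big(\tfrac{g(t)}{G(t)}\big)^k$ for $k=1,2$, where $G(t):=\tfrac12\int_0^t g(\tau)\,d\tau$ and $C_1,C_2$ are positive constants. Assume that $b$ is nonnegative with $\limsup_{t\to\infty}t\,b(t)<1$ and satisfies: (B'1) $b\in\mathcal C^1([0,\infty))$; (B'2) $b'(t)<0$; (B'3) $b^2(t)\lesssim -b'(t)$; (N-EF) $b(t)\le\widetilde C\,\tfrac{g(t)}{G(t)}$ for all $t\in[0,\infty)$, with a positive constant $\widetilde C$. Suppose that $(u_0,u_1)\in\dot H^{|\beta|}\times\dot H^{|\beta|-2}$ with $|\beta|\ge2$. Then Sobolev solutions satisfy $$\||D|^{|\beta|}u(t,\cdot)\|_{L^2}\lesssim \|u_0\|_{\dot H^{|\beta|}}+\|u_1\|_{\dot H^{|\beta|-2}},$$ $$\||D|^{|\beta|-2}u_t(t,\cdot)\|_{L^2}\lesssim g(t)\big(\|u_0\|_{\dot H^{|\beta|}}+\|u_1\|_{\dot H^{|\beta|-2}}\big).$$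
   Context: $f\lesssim h$ means $f\le Ch$ with a constant $C>0$ independent of $t$ and of the data. $|D|^a$ is the Fourier multiplier with symbol $|\xi|^a$; $\dot H^a=\dot H^a(\mathbb{R}^n)$ is the Riesz potential space based on $L^2$ with norm $\||\xi|^a\hat f\|_{L^2}$. $|\beta|$ denotes the order of differentiation (a number). Sobolev solutions are understood via the partial Fourier transform in $x$: $\hat u(t,\xi)$ solves $\hat u_{tt}+|\xi|^2\hat u+(b(t)+g(t)|\xi|^2)\hat u_t=0$, $\hat u(0,\xi)=\hat u_0(\xi)$, $\hat u_t(0,\xi)=\hat u_1(\xi)$. The coefficients are as regular as needed for the stated derivatives to exist. At $t=0$, where $G(0)=0$, the bounds involving $g/G$ are regarded as void. *)

theory Defs
  imports "HOL-Analysis.Analysis"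
begin

section \<open>Schwartz functions and the Fourier transform\<close>

primrec dpart :: "'a list \<Rightarrow> ('a::euclidean_space \<Rightarrow> complex) \<Rightarrow> 'a \<Rightarrow> complex" where
  "dpart [] \<phi> = \<phi>"
| "dpart (e # es) \<phi> = (\<lambda>x. frechet_derivative (dpart es \<phi>) (at x) e)"

definition schwartz :: "('a::euclidean_space \<Rightarrow> complex) \<Rightarrow> bool" where
  "schwartz \<phi> \<longleftrightarrow> (\<forall>es\<in>lists Basis. dpart es \<phi> differentiable_on UNIV \<and>
      (\<forall>k::nat. bounded (range (\<lambda>x. norm x ^ k *\<^sub>R dpart es \<phi> x))))"

text \<open>The unitary normalisation is used, so that Plancherel's identity holds without constants.\<close>

definition fourier :: "('a::euclidean_space \<Rightarrow> complex) \<Rightarrow> 'a \<Rightarrow> complex" where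
  "fourier \<phi> \<xi> = complex_of_real ((2 * pi) powr (- real DIM('a) / 2)) *
      (LINT x|lborel. cis (- (x \<bullet> \<xi>)) * \<phi> x)"

definition inv_fourier :: "('a::euclidean_space \<Rightarrow> complex) \<Rightarrow> 'a \<Rightarrow> complex" where
  "inv_fourier \<phi> x = complex_of_real ((2 * pi) powr (- real DIM('a) / 2)) *
      (LINT \<xi>|lborel. cis (x \<bullet> \<xi>) * \<phi> \<xi>)"

definition flat_at_0 :: "('a::euclidean_space \<Rightarrow> complex) \<Rightarrow> bool" where
  "flat_at_0 \<psi> \<longleftrightarrow> (\<forall>es\<in>lists Basis. dpart es \<psi> 0 = 0)"


section \<open>Tempered distributions modulo polynomials\<close>

text \<open>Riesz potential spaces are realised, as usual, inside the dual \<open>Z'\<close> of the space \<open>Z\<close> of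
  Schwartz functions whose Fourier transform vanishes to infinite order at the origin; \<open>Z'\<close> is
  the space of tempered distributions modulo polynomials.  This gives a meaning to all elements of
  the spaces, also when \<open>a \<ge> n / 2\<close>.  A distribution is a functional on all functions, of
  which only the values on \<open>Z\<close> matter.\<close>

definition Z_space :: "('a::euclidean_space \<Rightarrow> complex) set" where
  "Z_space = {\<phi>. schwartz \<phi> \<and> flat_at_0 (fourier \<phi>)}"

type_synonym 'a distr = "('a \<Rightarrow> complex) \<Rightarrow> complex"

text \<open>In the continuity clause, \<open>B\<close> ranges over the common bounds of the first \<open>N\<close>
  Schwartz seminorms of \<open>\<phi>\<close>.\<close>

definition Z_dual :: "('a::euclidean_space) distr set" where
  "Z_dual = {T.
     (\<forall>\<phi>\<in>Z_space. \<forall>\<psi>\<in>Z_space. \<forall>c d. T (\<lambda>x. c * \<phi> x + d * \<psi> x) = c * T \<phi> + d * T \<psi>) \<and>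
     (\<exists>N C. \<forall>\<phi>\<in>Z_space. \<forall>B.
        (\<forall>es\<in>lists Basis. \<forall>k\<le>N. \<forall>x. length es \<le> N \<longrightarrow> norm x ^ k * norm (dpart es \<phi> x) \<le> B)
          \<longrightarrow> norm (T \<phi>) \<le> C * B)}"

text \<open>The Fourier transform of \<open>T\<close>, defined by duality, is the function \<open>f\<close>.  Test functions
  flat at the origin are exactly those whose Fourier transform is in \<open>Z\<close>.  They include all
  test functions supported away from the origin, so \<open>f\<close> is locally integrable away from the
  origin, and unique up to a null set.\<close>

definition has_fourier :: "('a::euclidean_space) distr \<Rightarrow> ('a \<Rightarrow> complex) \<Rightarrow> bool" where
  "has_fourier T f \<longleftrightarrow> f \<in> borel_measurable borel \<and>
     (\<forall>\<psi>. schwartz \<psi> \<and> flat_at_0 \<psi> \<longrightarrow>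
        integrable lborel (\<lambda>\<xi>. f \<xi> * \<psi> \<xi>) \<and> T (fourier \<psi>) = (LINT \<xi>|lborel. f \<xi> * \<psi> \<xi>))"

definition Z_dual_fun :: "('a::euclidean_space) distr set" where
  "Z_dual_fun = {T \<in> Z_dual. \<exists>f. has_fourier T f}"

definition hat :: "('a::euclidean_space) distr \<Rightarrow> 'a \<Rightarrow> complex" where
  "hat T = (SOME f. has_fourier T f)"


section \<open>Riesz potential spaces and \<open>|D|^a\<close>\<close>

definition square_integrable :: "('a::euclidean_space \<Rightarrow> complex) \<Rightarrow> bool" where
  "square_integrable f \<longleftrightarrow> f \<in> borel_measurable borel \<and> integrable lborel (\<lambda>x. (norm (f x))\<^sup>2)"

definition L2norm :: "('a::euclidean_space \<Rightarrow> complex) \<Rightarrow> real" where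
  "L2norm f = sqrt (LINT x|lborel. (norm (f x))\<^sup>2)"

definition Hdot :: "real \<Rightarrow> ('a::euclidean_space) distr set" where
  "Hdot a = {T \<in> Z_dual_fun. square_integrable (\<lambda>\<xi>. norm \<xi> powr a *\<^sub>R hat T \<xi>)}"

definition Hdot_norm :: "real \<Rightarrow> ('a::euclidean_space) distr \<Rightarrow> real" where
  "Hdot_norm a T = L2norm (\<lambda>\<xi>. norm \<xi> powr a *\<^sub>R hat T \<xi>)"

text \<open>The Fourier multiplier with symbol \<open>|\<xi>|^a\<close>: the inverse Fourier transform, by duality, of
  \<open>|\<xi>|^a\<close> times the Fourier transform of \<open>T\<close>.\<close>

definition Dpow :: "real \<Rightarrow> ('a::euclidean_space) distr \<Rightarrow> 'a distr" where
  "Dpow a T = (\<lambda>\<phi>. LINT \<xi>|lborel. (norm \<xi> powr a *\<^sub>R hat T \<xi>) * inv_fourier \<phi> \<xi>)"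

definition L2_representative :: "('a::euclidean_space) distr \<Rightarrow> ('a \<Rightarrow> complex) \<Rightarrow> bool" where
  "L2_representative S f \<longleftrightarrow> square_integrable f \<and> (\<forall>\<phi>\<in>Z_space. S \<phi> = (LINT x|lborel. f x * \<phi> x))"

text \<open>The norm in \<open>L\<^sup>2\<close> of a distribution in the space variable.  A representative is unique
  up to a null set since \<open>Z\<close> is dense in \<open>L\<^sup>2\<close>; the infimum over the empty set makes the
  norm infinite for a distribution not in \<open>L\<^sup>2\<close>.\<close>

definition L2norm_distr :: "('a::euclidean_space) distr \<Rightarrow> ennreal" where
  "L2norm_distr S = (INF f\<in>{f. L2_representative S f}. ennreal (L2norm f))"


section \<open>Sobolev solutions\<close>

definition fourier_ode ::
  "(real \<Rightarrow> real) \<Rightarrow> (real \<Rightarrow> real) \<Rightarrow> real \<Rightarrow> (real \<Rightarrow> complex) \<Rightarrow> (real \<Rightarrow> complex) \<Rightarrow> bool" where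
  "fourier_ode b g r y y' \<longleftrightarrow>
     (\<forall>t\<ge>0. (y has_vector_derivative y' t) (at t within {0..})) \<and>
     continuous_on {0..} y' \<and>
     (\<forall>t>0. \<exists>y2. (y' has_vector_derivative y2) (at t) \<and>
        y2 + of_real (r\<^sup>2) * y t + of_real (b t + g t * r\<^sup>2) * y' t = 0)"

text \<open>\<open>ut\<close> is the time derivative of \<open>u\<close>.  Since \<open>hat\<close> is only determined up to null sets for
  each time separately, the differential equation is required of suitable versions \<open>w\<close>, \<open>v\<close>
  of the Fourier transforms of \<open>u\<close> and \<open>ut\<close>.\<close>

definition sobolev_solution ::
  "(real \<Rightarrow> real) \<Rightarrow> (real \<Rightarrow> real) \<Rightarrow> ('a::euclidean_space) distr \<Rightarrow> 'a distr \<Rightarrow>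
     (real \<Rightarrow> 'a distr) \<Rightarrow> (real \<Rightarrow> 'a distr) \<Rightarrow> bool" where
  "sobolev_solution b g u0 u1 u ut \<longleftrightarrow>
     (\<forall>t\<ge>0. u t \<in> Z_dual_fun \<and> ut t \<in> Z_dual_fun) \<and>
     (\<exists>w v.
        (\<forall>t\<ge>0. AE \<xi> in lborel. w t \<xi> = hat (u t) \<xi> \<and> v t \<xi> = hat (ut t) \<xi>) \<and>
        (AE \<xi> in lborel. w 0 \<xi> = hat u0 \<xi> \<and> v 0 \<xi> = hat u1 \<xi> \<and>
           fourier_ode b g (norm \<xi>) (\<lambda>t. w t \<xi>) (\<lambda>t. v t \<xi>)))"


section \<open>Coefficients\<close>

definition half_primitive :: "(real \<Rightarrow> real) \<Rightarrow> real \<Rightarrow> real" where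
  "half_primitive g t = (1 / 2) * integral {0..t} g"

end

theory Submission
  imports Defs "HOL-Probability.Characteristic_Functions" "HOL-Probability.Sinc_Integral"
begin

text \<open>On the Fourier side every frequency \<open>r = |\<xi>|\<close> carries an oscillator
  \<open>y'' + r\<^sup>2 y + (b + g r\<^sup>2) y' = 0\<close>, and the claim follows from the frequency-independent bounds
  \<open>|y t| \<le> C (|y 0| + |y' 0| / r\<^sup>2)\<close> and \<open>|y' t| \<le> C g(t) (r\<^sup>2 |y 0| + |y' 0|)\<close>, multiplied by
  \<open>r powr \<beta>\<close> and \<open>r powr (\<beta> - 2)\<close> respectively, when they are squared and integrated over \<open>\<xi>\<close>.

  These bounds, \<open>overdamped_oscillator_bound\<close>, express that the damping \<open>g r\<^sup>2\<close> wins against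
  the oscillation: a disturbance of the velocity dies out in time \<open>1 / (g r\<^sup>2)\<close>, after which
  \<open>y'\<close> is of size at most \<open>|y| / g\<close>, so \<open>|y|\<close> grows at most like \<open>exp (\<integral> 1 / g)\<close>, which is bounded
  as \<open>1 / g\<close> is integrable. The initial velocity can displace \<open>y\<close> only by
  \<open>|y' 0| / (g(0) r\<^sup>2)\<close>; this is the gain of two derivatives for the second datum. Nonnegative
  friction \<open>b\<close> only adds to the damping.

  The norms in the claim are those of distributions in \<open>x\<close>. To pass to them from bounds on
  Fourier transforms, each square integrable function on the Fourier side must be shown to have
  an inverse transform, in the sense of duality with Schwartz functions, of no larger norm
  (\<open>square_integrable_inverse_transform\<close>). This rests on the inequality half of Plancherel's
  theorem for integrable functions (\<open>Plancherel_le\<close>), obtained by Gaussian regularisation, and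
  on a completeness argument in the style of Riesz and Fischer.\<close>

section \<open>The overdamped oscillator\<close>

lemma has_real_derivative_primitive:
  fixes f :: "real \<Rightarrow> real"
  assumes "continuous_on {0..} f" "x > 0"
  shows "((\<lambda>x. integral {0..x} f) has_real_derivative f x) (at x)"
proof -
  have "((\<lambda>x. integral {0..x} f) has_real_derivative f x) (at x within {0..x+1})"
    using assms by (intro integral_has_real_derivative continuous_on_subset[OF assms(1)]) auto
  then show ?thesis
    using at_within_Icc_at[of 0 x "x+1"] assms(2) by simp
qed

lemma continuous_on_primitive:
  fixes f :: "real \<Rightarrow> real"
  assumes "continuous_on {0..} f"
  shows "continuous_on {0..T} (\<lambda>x. integral {0..x} f)"
  by (intro indefinite_integral_continuous_1 integrable_continuous_real continuous_on_subset[OF assms]) auto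

lemma continuous_on_primitive_atLeast:
  fixes f :: "real \<Rightarrow> real"
  assumes "continuous_on {0..} f"
  shows "continuous_on {0..} (\<lambda>x. integral {0..x} f)"
  unfolding continuous_on_eq_continuous_within
proof
  fix x :: real assume x: "x \<in> {0..}"
  have "continuous (at x within {0..x+1}) (\<lambda>x. integral {0..x} f)"
    using continuous_on_primitive[OF assms, of "x+1"] x
    by (simp add: continuous_on_eq_continuous_within)
  moreover have "at x within {0..x+1} = at x within {0..}"
    using x by (intro at_within_nhd[of x "{..<x+1}"]) auto
  ultimately show "continuous (at x within {0..}) (\<lambda>x. integral {0..x} f)" by simp
qed

text \<open>The velocity relaxes at the rate \<open>m = b + g * r\<^sup>2\<close> towards the quasi-static value
  \<open>- r\<^sup>2 * y / m\<close>, of modulus at most \<open>norm y / g\<close>. To turn this into a bound without losing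
  powers of \<open>r\<close>, the moduli of \<open>y\<close> and \<open>y'\<close> are majorised by the solutions \<open>W = norm (y 0) + V\<close> and \<open>Q\<close> of the
  nonoscillating system \<open>W' = Q\<close>, \<open>Q' = r\<^sup>2 * norm y - m * Q\<close>. In the functional \<open>S = W + Q / (r\<^sup>2 * g)\<close> the fast
  relaxation cancels \<open>W'\<close>; what remains, because \<open>b\<close> and \<open>g'\<close> are nonnegative, is
  \<open>S' \<le> norm y / g \<le> S / g\<close>, which integrates to a bound by
  \<open>exp (\<integral> 1 / g)\<close>. Both estimates are read off from \<open>S\<close>; the growth factor \<open>g\<close> of the
  velocity estimate is the weight of \<open>Q\<close> in \<open>S\<close>.\<close>

lemma overdamped_oscillator_bound:
  fixes y y' :: "real \<Rightarrow> complex"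
  assumes ode: "fourier_ode b g r y y'" and r: "r > 0"
    and g_deriv: "\<And>t. t \<ge> 0 \<Longrightarrow> (g has_real_derivative g' t) (at t within {0..})"
    and g_pos: "\<And>t. t \<ge> 0 \<Longrightarrow> g t > 0" and g'_pos: "\<And>t. t \<ge> 0 \<Longrightarrow> g' t \<ge> 0"
    and b_cont: "continuous_on {0..} b" and b_nonneg: "\<And>t. t \<ge> 0 \<Longrightarrow> b t \<ge> 0"
    and K: "\<And>t. t \<ge> 0 \<Longrightarrow> integral {0..t} (\<lambda>s. 1 / g s) \<le> K"
    and T: "T \<ge> 0"
  shows "norm (y T) \<le> exp K * (norm (y 0) + norm (y' 0) / (r\<^sup>2 * g 0))"
    and "norm (y' T) \<le> r\<^sup>2 * g T * (exp K * (norm (y 0) + norm (y' 0) / (r\<^sup>2 * g 0)))"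
proof -
  have y_deriv: "(y has_vector_derivative y' t) (at t within {0..})" if "t \<ge> 0" for t
    using ode that by (simp add: fourier_ode_def)
  have y'_cont: "continuous_on {0..} y'"
    using ode by (simp add: fourier_ode_def)
  have y'_deriv: "(y' has_vector_derivative
      - (of_real (r\<^sup>2) * y t + of_real (b t + g t * r\<^sup>2) * y' t)) (at t)" if t: "t > 0" for t
  proof -
    obtain y2 where "(y' has_vector_derivative y2) (at t)"
      "y2 + of_real (r\<^sup>2) * y t + of_real (b t + g t * r\<^sup>2) * y' t = 0"
      using ode t unfolding fourier_ode_def by blast
    moreover from this(2) have
      "y2 = - (of_real (r\<^sup>2) * y t + of_real (b t + g t * r\<^sup>2) * y' t)"
      by (simp only: eq_neg_iff_add_eq_0 add.assoc)
    ultimately show ?thesis by simp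
  qed
  have within: "at t within {0..} = at t" if "t > 0" for t :: real
    using that by (intro at_within_interior) simp
  have y_cont: "continuous_on {0..} y"
    unfolding continuous_on_eq_continuous_within
    using y_deriv by (blast intro: has_vector_derivative_continuous)
  have g_cont: "continuous_on {0..} g"
    using g_deriv by (intro DERIV_continuous_on) auto
  have g_nz: "g t \<noteq> 0" if "t \<ge> 0" for t using g_pos[OF that] by simp

  define m where "m = (\<lambda>t. b t + g t * r\<^sup>2)"
  define B where "B = (\<lambda>t. integral {0..t} m)"
  define U where "U = (\<lambda>t. integral {0..t} (\<lambda>s. exp (B s) * norm (y s)))"
  define Q where "Q = (\<lambda>t. exp (- B t) * (norm (y' 0) + r\<^sup>2 * U t))"
  define V where "V = (\<lambda>t. integral {0..t} Q)"
  define S where "S = (\<lambda>t. norm (y 0) + V t + Q t / (r\<^sup>2 * g t))"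
  define P where "P = (\<lambda>t. integral {0..t} (\<lambda>s. 1 / g s))"
  have m_cont: "continuous_on {0..} m"
    unfolding m_def by (intro continuous_intros b_cont g_cont)
  have B_cont: "continuous_on {0..} B"
    unfolding B_def by (intro continuous_on_primitive_atLeast m_cont)
  have eBy_cont: "continuous_on {0..} (\<lambda>s. exp (B s) * norm (y s))"
    by (intro continuous_intros B_cont y_cont)
  have U_cont: "continuous_on {0..} U"
    unfolding U_def by (intro continuous_on_primitive_atLeast eBy_cont)
  have Q_cont: "continuous_on {0..} Q"
    unfolding Q_def by (intro continuous_intros B_cont U_cont)
  have V_cont: "continuous_on {0..} V"
    unfolding V_def by (intro continuous_on_primitive_atLeast Q_cont)
  have ginv_cont: "continuous_on {0..} (\<lambda>s. 1 / g s)"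
    using g_nz by (intro continuous_intros g_cont) auto
  have P_cont: "continuous_on {0..} P"
    unfolding P_def by (intro continuous_on_primitive_atLeast ginv_cont)
  have S_cont: "continuous_on {0..} S"
    unfolding S_def using g_nz r by (intro continuous_intros V_cont Q_cont g_cont) auto
  have dB: "(B has_real_derivative m t) (at t)" if "t > 0" for t
    unfolding B_def by (intro has_real_derivative_primitive m_cont that)
  have dU: "(U has_real_derivative exp (B t) * norm (y t)) (at t)" if "t > 0" for t
    unfolding U_def by (intro has_real_derivative_primitive eBy_cont that)
  have dV: "(V has_real_derivative Q t) (at t)" if "t > 0" for t
    unfolding V_def by (intro has_real_derivative_primitive Q_cont that)
  have dP: "(P has_real_derivative 1 / g t) (at t)" if "t > 0" for t
    unfolding P_def by (intro has_real_derivative_primitive ginv_cont that)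
  have dg: "(g has_real_derivative g' t) (at t)" if "t > 0" for t
    using g_deriv[of t] within[OF that] that by simp
  have dQ: "(Q has_real_derivative r\<^sup>2 * norm (y t) - m t * Q t) (at t)" if "t > 0" for t
    unfolding Q_def
    by (rule derivative_eq_intros dB[OF that] dU[OF that] refl)+
       (simp add: algebra_simps flip: exp_add)
  have zero [simp]: "B 0 = 0" "U 0 = 0" "V 0 = 0" "P 0 = 0"
    by (simp_all add: B_def U_def V_def P_def)
  have U_nonneg: "U t \<ge> 0" for t
    unfolding U_def by (intro Henstock_Kurzweil_Integration.integral_nonneg
      integrable_continuous_real continuous_on_subset[OF eBy_cont]) auto
  have Q_nonneg: "Q t \<ge> 0" for t
    unfolding Q_def using U_nonneg[of t] by (intro mult_nonneg_nonneg add_nonneg_nonneg) auto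

  \<comment> \<open>Variation of constants: \<open>B\<close> is a primitive of the damping \<open>m\<close>, so the derivative of \<open>exp B * y'\<close>
    contains only the restoring force.\<close>
  have y'_le_Q: "norm (y' t) \<le> Q t" if t: "t \<ge> 0" for t
  proof (cases "t = 0")
    case False
    with t have t: "t > 0" by simp
    have "norm (of_real (exp (B t)) * y' t - of_real (exp (B 0)) * y' 0)
        \<le> r\<^sup>2 * U t - r\<^sup>2 * U 0"
    proof (rule differentiable_bound_general[OF t])
      show "continuous_on {0..t} (\<lambda>t. of_real (exp (B t)) * y' t)"
        by (intro continuous_intros continuous_on_subset[OF B_cont] continuous_on_subset[OF y'_cont]) auto
      show "continuous_on {0..t} (\<lambda>t. r\<^sup>2 * U t)"
        by (intro continuous_intros continuous_on_subset[OF U_cont]) auto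
      fix s assume s: "0 < s" "s < t"
      have "((\<lambda>t. of_real (exp (B t)) :: complex) has_vector_derivative
          of_real (exp (B s) * m s)) (at s)"
        by (intro has_vector_derivative_of_real DERIV_fun_exp[OF dB[OF s(1)]])
      from has_vector_derivative_mult[OF this y'_deriv[OF s(1)]]
      show "((\<lambda>t. of_real (exp (B t)) * y' t) has_vector_derivative
          - (of_real (exp (B s) * r\<^sup>2) * y s)) (at s)"
        by (simp add: m_def algebra_simps)
      show "((\<lambda>t. r\<^sup>2 * U t) has_vector_derivative r\<^sup>2 * (exp (B s) * norm (y s))) (at s)"
        using DERIV_cmult[OF dU[OF s(1)]] by (simp add: has_real_derivative_iff_has_vector_derivative)
      show "norm (- (complex_of_real (exp (B s) * r\<^sup>2) * y s)) \<le> r\<^sup>2 * (exp (B s) * norm (y s))"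
        by (simp add: norm_mult norm_power)
    qed
    then have "norm (of_real (exp (B t)) * y' t - y' 0) \<le> r\<^sup>2 * U t" by simp
    then have "norm (of_real (exp (B t)) * y' t) \<le> norm (y' 0) + r\<^sup>2 * U t"
      using norm_triangle_ineq2[of "of_real (exp (B t)) * y' t" "y' 0"] by linarith
    then have "exp (B t) * norm (y' t) \<le> norm (y' 0) + r\<^sup>2 * U t"
      by (simp add: norm_mult)
    then show ?thesis by (simp add: Q_def exp_minus field_simps)
  qed (simp add: Q_def)

  have y_le: "norm (y t) \<le> norm (y 0) + V t" if t: "t \<ge> 0" for t
  proof (cases "t = 0")
    case False
    with t have t: "t > 0" by simp
    have "norm (y t - y 0) \<le> V t - V 0"
    proof (rule differentiable_bound_general[OF t])
      show "continuous_on {0..t} y" "continuous_on {0..t} V"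
        by (auto intro: continuous_on_subset[OF y_cont] continuous_on_subset[OF V_cont])
      fix s assume s: "0 < s" "s < t"
      show "(y has_vector_derivative y' s) (at s)"
        using y_deriv[of s] within[OF s(1)] s by simp
      show "(V has_vector_derivative Q s) (at s)"
        using dV[OF s(1)] by (simp add: has_real_derivative_iff_has_vector_derivative)
      show "norm (y' s) \<le> Q s" using y'_le_Q s by simp
    qed
    then show ?thesis using norm_triangle_ineq2[of "y t" "y 0"] by simp
  qed simp

  have V_nonneg: "V t \<ge> 0" if "t \<ge> 0" for t
    unfolding V_def using Q_nonneg by (intro Henstock_Kurzweil_Integration.integral_nonneg
      integrable_continuous_real continuous_on_subset[OF Q_cont]) auto
  have y_le_S: "norm (y t) \<le> S t" if "t \<ge> 0" for t
    using y_le[OF that] Q_nonneg[of t] g_pos[OF that] r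
    unfolding S_def by (smt (verit) divide_nonneg_nonneg mult_nonneg_nonneg zero_le_power2)
  have S_nonneg: "S t \<ge> 0" if "t \<ge> 0" for t
    using y_le_S[OF that] norm_ge_zero[of "y t"] by linarith

  have dS: "\<exists>d. (S has_real_derivative d) (at t) \<and> d \<le> S t / g t" if t: "t > 0" for t
  proof (intro exI conjI)
    have gt: "g t > 0" using g_pos t by simp
    let ?d = "Q t + ((r\<^sup>2 * norm (y t) - m t * Q t) * (r\<^sup>2 * g t) - Q t * (r\<^sup>2 * g' t))
          / (r\<^sup>2 * g t * (r\<^sup>2 * g t))"
    show "(S has_real_derivative ?d) (at t)"
      unfolding S_def using r gt
      by (auto intro!: derivative_eq_intros dV[OF t] dQ[OF t] dg[OF t])
    have "?d = norm (y t) / g t - Q t * b t / (r\<^sup>2 * g t) - Q t * g' t / (r\<^sup>2 * (g t)\<^sup>2)"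
      using r gt by (simp add: m_def divide_simps) (simp add: algebra_simps power2_eq_square power4_eq_xxxx)
    also have "\<dots> \<le> norm (y t) / g t"
    proof -
      have "0 \<le> Q t * b t / (r\<^sup>2 * g t)" "0 \<le> Q t * g' t / (r\<^sup>2 * (g t)\<^sup>2)"
        using Q_nonneg[of t] b_nonneg[of t] g'_pos[of t] gt r t by auto
      then show ?thesis by linarith
    qed
    also have "\<dots> \<le> S t / g t"
      using y_le_S[of t] t gt by (intro divide_right_mono) auto
    finally show "?d \<le> S t / g t" .
  qed

  have "S T * exp (- P T) \<le> S 0 * exp (- P 0)"
  proof (rule DERIV_nonpos_imp_decreasing_open[OF T])
    show "continuous_on {0..T} (\<lambda>t. S t * exp (- P t))"
      by (intro continuous_intros continuous_on_subset[OF S_cont] continuous_on_subset[OF P_cont]) auto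
    fix t assume t: "0 < t" "t < T"
    obtain d where d: "(S has_real_derivative d) (at t)" "d \<le> S t / g t"
      using dS[OF t(1)] by blast
    have "((\<lambda>t. S t * exp (- P t)) has_real_derivative (d - S t / g t) * exp (- P t)) (at t)"
      by (rule derivative_eq_intros d(1) dP[OF t(1)] refl)+ (simp add: algebra_simps)
    moreover have "(d - S t / g t) * exp (- P t) \<le> 0"
      using d(2) by (intro mult_nonpos_nonneg) auto
    ultimately show "\<exists>e. ((\<lambda>t. S t * exp (- P t)) has_real_derivative e) (at t) \<and> e \<le> 0"
      by blast
  qed
  then have "S T \<le> exp (P T) * S 0"
    by (simp add: exp_minus field_simps)
  also have "\<dots> \<le> exp K * S 0"
    using K[OF T] S_nonneg[of 0] by (intro mult_right_mono) (auto simp: P_def)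
  also have "S 0 = norm (y 0) + norm (y' 0) / (r\<^sup>2 * g 0)"
    by (simp add: S_def Q_def)
  finally have S_le: "S T \<le> exp K * (norm (y 0) + norm (y' 0) / (r\<^sup>2 * g 0))" .
  then show "norm (y T) \<le> exp K * (norm (y 0) + norm (y' 0) / (r\<^sup>2 * g 0))"
    using y_le_S[OF T] by linarith
  have gT: "r\<^sup>2 * g T > 0" using g_pos[OF T] r by simp
  have "Q T / (r\<^sup>2 * g T) \<le> S T" 
    using V_nonneg[OF T] unfolding S_def by simp
  then have "Q T \<le> r\<^sup>2 * g T * S T" using gT by (simp add: pos_divide_le_eq mult.commute)
  also have "\<dots> \<le> r\<^sup>2 * g T * (exp K * (norm (y 0) + norm (y' 0) / (r\<^sup>2 * g 0)))"
    using S_le gT by (intro mult_left_mono) auto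
  finally show "norm (y' T) \<le> r\<^sup>2 * g T * (exp K * (norm (y 0) + norm (y' 0) / (r\<^sup>2 * g 0)))"
    using y'_le_Q[OF T] by linarith
qed

section \<open>Preliminaries on integrals\<close>

lemma measurable_cis [measurable]: "cis \<in> borel_measurable borel"
proof (rule borel_measurable_continuous_onI)
  show "continuous_on UNIV cis"
    unfolding cis_conv_exp by (intro continuous_intros)
qed

lemma measurable_cnj [measurable]: "cnj \<in> borel_measurable borel"
  by (intro borel_measurable_continuous_onI continuous_intros)

lemma (in pair_sigma_finite) integrable_mult_product:
  fixes f :: "'a \<Rightarrow> complex" and h :: "'b \<Rightarrow> complex"
  assumes f: "integrable M1 f" and h: "integrable M2 h"
  shows "integrable (M1 \<Otimes>\<^sub>M M2) (\<lambda>p. f (fst p) * h (snd p))"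
proof (rule Fubini_integrable)
  note [measurable] = borel_measurable_integrable[OF f] borel_measurable_integrable[OF h]
  show "(\<lambda>p. f (fst p) * h (snd p)) \<in> borel_measurable (M1 \<Otimes>\<^sub>M M2)" by measurable
  show "integrable M1 (\<lambda>x. LINT y|M2. norm (f (fst (x, y)) * h (snd (x, y))))"
    using f by (simp add: norm_mult)
  show "AE x in M1. integrable M2 (\<lambda>y. f (fst (x, y)) * h (snd (x, y)))"
    using h by simp
qed

lemma (in pair_sigma_finite) integral_mult_product:
  fixes f :: "'a \<Rightarrow> complex" and h :: "'b \<Rightarrow> complex"
  assumes f: "integrable M1 f" and h: "integrable M2 h"
  shows "(LINT p|(M1 \<Otimes>\<^sub>M M2). f (fst p) * h (snd p)) = (LINT x|M1. f x) * (LINT y|M2. h y)"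
  using integral_fst'[OF integrable_mult_product[OF f h]] h by simp

lemma Fatou_bound:
  fixes u :: "nat \<Rightarrow> 'a \<Rightarrow> ennreal"
  assumes [measurable]: "\<And>k. u k \<in> borel_measurable M"
    and lim: "AE x in M. (\<lambda>k. u k x) \<longlonglongrightarrow> v x"
    and bound: "\<forall>\<^sub>F k in sequentially. (\<integral>\<^sup>+x. u k x \<partial>M) \<le> C"
  shows "(\<integral>\<^sup>+x. v x \<partial>M) \<le> C"
proof -
  have "(\<integral>\<^sup>+x. v x \<partial>M) = (\<integral>\<^sup>+x. liminf (\<lambda>k. u k x) \<partial>M)"
  proof (rule nn_integral_cong_AE)
    show "AE x in M. v x = liminf (\<lambda>k. u k x)"
      using lim by (rule eventually_mono) (simp add: lim_imp_Liminf)
  qed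
  also have "\<dots> \<le> liminf (\<lambda>k. \<integral>\<^sup>+x. u k x \<partial>M)"
    by (intro nn_integral_liminf) auto
  also have "\<dots> \<le> limsup (\<lambda>k. \<integral>\<^sup>+x. u k x \<partial>M)"
    by (intro Liminf_le_Limsup) auto
  also have "\<dots> \<le> C"
    using bound by (intro Limsup_bounded)
  finally show ?thesis .
qed

section \<open>Gaussian cutoffs\<close>

text \<open>This is the characteristic function of the standard normal distribution, rescaled. Writing
  the transform as a normal density makes its total mass visible.\<close>

lemma gaussian_integral:
  assumes "\<sigma> > 0"
  shows "integrable lborel (\<lambda>x. complex_of_real (exp (- (x / \<sigma>)\<^sup>2 / 2)) * cis (x * t))"
    and "(LINT x|lborel. complex_of_real (exp (- (x / \<sigma>)\<^sup>2 / 2)) * cis (x * t)) =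
      complex_of_real (2 * pi * normal_density 0 (1 / \<sigma>) t)"
proof -
  let ?h = "\<lambda>x. complex_of_real (std_normal_density x) * cis (\<sigma> * t * x)"
  have h_int: "integrable lborel ?h"
  proof (rule Bochner_Integration.integrable_bound)
    show "integrable lborel std_normal_density" by simp
    show "?h \<in> borel_measurable lborel" by measurable
  qed (simp add: norm_mult)
  have "char std_normal_distribution (\<sigma> * t) = (LINT x|lborel. ?h x)"
    unfolding char_def by (subst integral_density) (auto simp: scaleR_conv_of_real cis_conv_exp)
  then have h_eq: "(LINT x|lborel. ?h x) = complex_of_real (exp (- (\<sigma> * t)\<^sup>2 / 2))"
    by (simp add: char_std_normal_distribution)
  let ?f = "\<lambda>x. complex_of_real (exp (- (x / \<sigma>)\<^sup>2 / 2)) * cis (x * t)"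
  have f_eq: "?f (0 + \<sigma> * x) = complex_of_real (sqrt (2 * pi)) * ?h x" for x
    using assms by (simp add: std_normal_density_def field_simps)
  have "integrable lborel (\<lambda>x. ?f (0 + \<sigma> * x))"
    unfolding f_eq using h_int by (intro integrable_mult_right)
  then show "integrable lborel ?f"
    using lborel_integrable_real_affine_iff[of \<sigma> ?f 0] assms by simp
  have "(LINT x|lborel. ?f x) = \<bar>\<sigma>\<bar> *\<^sub>R (LINT x|lborel. ?f (0 + \<sigma> * x))"
    using assms by (intro lborel_integral_real_affine) simp
  also have "\<dots> = complex_of_real (\<sigma> * sqrt (2 * pi) * exp (- (\<sigma> * t)\<^sup>2 / 2))"
    unfolding f_eq using assms h_eq by (simp add: scaleR_conv_of_real)
  also have "\<sigma> * sqrt (2 * pi) * exp (- (\<sigma> * t)\<^sup>2 / 2) = 2 * pi * normal_density 0 (1 / \<sigma>) t"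
    using assms by (simp add: normal_density_def real_sqrt_divide field_simps power_divide power_mult_distrib)
  finally show "(LINT x|lborel. ?f x) = complex_of_real (2 * pi * normal_density 0 (1 / \<sigma>) t)" .
qed

text \<open>Lebesgue measure is the product of its coordinate measures, which reduces
  Gaussian integrals in any dimension to dimension one.\<close>

lemma lborel_integral_prod:
  fixes f :: "'a::euclidean_space \<Rightarrow> real \<Rightarrow> complex"
  assumes int: "\<And>b. b \<in> Basis \<Longrightarrow> integrable lborel (f b)"
  shows "integrable lborel (\<lambda>x. \<Prod>b\<in>Basis. f b (x \<bullet> b))"
    and "(LINT x|lborel. (\<Prod>b\<in>Basis. f b (x \<bullet> b))) = (\<Prod>b\<in>Basis. LINT x|lborel. f b x)"
proof -
  interpret product_sigma_finite "\<lambda>_::'a. lborel :: real measure" ..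
  have [measurable]: "f b \<in> borel_measurable borel" if "b \<in> Basis" for b
    using borel_measurable_integrable[OF int[OF that]] by simp
  have coord: "(\<Sum>b\<in>Basis. p b *\<^sub>R b) \<bullet> c = p c" if "c \<in> Basis" for p and c :: 'a
    using that by (simp add: inner_sum_left inner_Basis if_distrib cong: if_cong)
  have meas: "(\<lambda>x. \<Prod>b\<in>Basis. f b (x \<bullet> b)) \<in> borel_measurable borel" by measurable
  show "integrable lborel (\<lambda>x. \<Prod>b\<in>Basis. f b (x \<bullet> b))"
    unfolding lborel_eq[where 'a='a] using product_integrable_prod[OF finite_Basis int] meas
    by (subst integrable_distr_eq) (auto simp: coord cong: Bochner_Integration.integrable_cong)
  show "(LINT x|lborel. (\<Prod>b\<in>Basis. f b (x \<bullet> b))) = (\<Prod>b\<in>Basis. LINT x|lborel. f b x)"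
    unfolding lborel_eq[where 'a='a] using product_integral_prod[OF finite_Basis int] meas
    by (subst integral_distr) (auto simp: coord cong: Bochner_Integration.integral_cong)
qed

text \<open>The cutoff tends to one as \<open>\<sigma>\<close> grows. Its Fourier transform is, up to the factor
  \<open>(2 * pi) ^ DIM('a)\<close>, the kernel of width \<open>s = 1 / \<sigma>\<close>, an approximate identity.\<close>

definition gauss_cutoff :: "real \<Rightarrow> 'a::euclidean_space \<Rightarrow> real" where
  "gauss_cutoff \<sigma> x = (\<Prod>b\<in>Basis. exp (- ((x \<bullet> b) / \<sigma>)\<^sup>2 / 2))"

definition gauss_kernel :: "real \<Rightarrow> 'a::euclidean_space \<Rightarrow> real" where
  "gauss_kernel s x = (\<Prod>b\<in>Basis. normal_density 0 s (x \<bullet> b))"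

lemma gauss_cutoff_measurable [measurable]: "gauss_cutoff \<sigma> \<in> borel_measurable borel"
  unfolding gauss_cutoff_def by measurable

lemma gauss_kernel_measurable [measurable]: "gauss_kernel \<sigma> \<in> borel_measurable borel"
  unfolding gauss_kernel_def by measurable

lemma gauss_cutoff_nonneg: "gauss_cutoff \<sigma> x \<ge> 0"
  unfolding gauss_cutoff_def by (intro prod_nonneg) auto

lemma gauss_kernel_nonneg: "gauss_kernel \<sigma> x \<ge> 0"
  unfolding gauss_kernel_def by (intro prod_nonneg) auto

lemma gauss_kernel_minus_commute: "gauss_kernel \<sigma> (x - y) = gauss_kernel \<sigma> (y - x)"
proof -
  have "((x - y) \<bullet> b)\<^sup>2 = ((y - x) \<bullet> b)\<^sup>2" for b
    by (simp add: inner_diff_left power2_commute)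
  then show ?thesis by (simp add: gauss_kernel_def normal_density_def)
qed

lemma gauss_cutoff_tendsto_1: "(\<lambda>k. gauss_cutoff (real (Suc k)) x) \<longlonglongrightarrow> 1"
proof -
  have lim: "(\<lambda>k. c / real (Suc k)) \<longlonglongrightarrow> 0" for c :: real
    using LIMSEQ_inverse_real_of_nat[THEN tendsto_mult_right, of c] by (simp add: field_simps)
  have "(\<lambda>k. gauss_cutoff (real (Suc k)) x) \<longlonglongrightarrow> (\<Prod>b\<in>(Basis::'a set). exp (- 0\<^sup>2 / 2))"
    unfolding gauss_cutoff_def
    by (intro tendsto_prod tendsto_exp tendsto_divide tendsto_minus tendsto_power tendsto_const lim) auto
  then show ?thesis by simp
qed

lemma gauss_cutoff_integrable:
  assumes "\<sigma> > 0"
  shows "integrable lborel (gauss_cutoff \<sigma> :: 'a::euclidean_space \<Rightarrow> real)"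
proof -
  have "integrable lborel (\<lambda>x::'a. \<Prod>b\<in>Basis. (\<lambda>x. complex_of_real (exp (- (x / \<sigma>)\<^sup>2 / 2))) (x \<bullet> b))"
    using gaussian_integral(1)[OF assms, of 0] by (intro lborel_integral_prod(1)) simp
  then have "integrable lborel (\<lambda>x::'a. complex_of_real (gauss_cutoff \<sigma> x))"
    by (simp add: gauss_cutoff_def)
  then show ?thesis by (simp only: complex_of_real_integrable_eq)
qed

lemma cis_inner_eq_prod: "cis (x \<bullet> y) = (\<Prod>b\<in>Basis. cis ((x \<bullet> b) * (y \<bullet> b)))"
  by (subst euclidean_inner) (simp add: cis_conv_exp sum_distrib_left exp_sum)

lemma gauss_cutoff_transform:
  fixes y :: "'a::euclidean_space"
  assumes "\<sigma> > 0"
  shows "(LINT x|lborel. complex_of_real (gauss_cutoff \<sigma> x) * cis (x \<bullet> y)) =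
    complex_of_real ((2 * pi) ^ DIM('a) * gauss_kernel (1 / \<sigma>) y)"
proof -
  have "(LINT x|lborel. complex_of_real (gauss_cutoff \<sigma> x) * cis (x \<bullet> y)) =
     (LINT x|lborel. (\<Prod>b\<in>Basis. complex_of_real (exp (- ((x \<bullet> b) / \<sigma>)\<^sup>2 / 2)) * cis ((x \<bullet> b) * (y \<bullet> b))))"
    unfolding cis_inner_eq_prod gauss_cutoff_def prod.distrib of_real_prod ..
  also have "\<dots> = (\<Prod>b\<in>Basis. LINT x|lborel. complex_of_real (exp (- (x / \<sigma>)\<^sup>2 / 2)) * cis (x * (y \<bullet> b)))"
    using gaussian_integral(1)[OF assms]
    by (intro lborel_integral_prod(2)[of "\<lambda>b x. complex_of_real (exp (- (x / \<sigma>)\<^sup>2 / 2)) * cis (x * (y \<bullet> b))"])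
  also have "\<dots> = complex_of_real ((2 * pi) ^ DIM('a) * gauss_kernel (1 / \<sigma>) y)"
    unfolding gaussian_integral(2)[OF assms] by (simp add: gauss_kernel_def prod.distrib)
  finally show ?thesis .
qed

lemma gauss_kernel_nn_integral:
  fixes y :: "'a::euclidean_space"
  assumes "s > 0"
  shows "(\<integral>\<^sup>+x. gauss_kernel s (x - y) \<partial>lborel) = 1"
proof -
  have "(\<integral>\<^sup>+x. gauss_kernel s (x - y) \<partial>lborel) =
      (\<integral>\<^sup>+x. gauss_kernel s (- y + x) \<partial>lborel)" by simp
  also have "\<dots> = (\<integral>\<^sup>+x. gauss_kernel s x \<partial>distr lborel borel ((+) (- y)))"
    by (subst nn_integral_distr) auto
  also have "\<dots> = (\<integral>\<^sup>+(x::'a). (\<Prod>b\<in>Basis. ennreal (normal_density 0 s (x \<bullet> b))) \<partial>lborel)"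
    by (simp add: lborel_distr_plus gauss_kernel_def prod_ennreal)
  also have "\<dots> = (\<Prod>b\<in>(Basis::'a set). \<integral>\<^sup>+x. ennreal (normal_density 0 s x) \<partial>lborel)"
    by (intro nn_integral_lborel_prod) auto
  also have "(\<integral>\<^sup>+x. ennreal (normal_density 0 s x) \<partial>lborel) = 1"
    using assms by (subst nn_integral_eq_integral) auto
  finally show ?thesis by simp
qed

section \<open>The inequality half of Plancherel's theorem\<close>

lemma integrable_cis_mult:
  fixes F :: "'a::euclidean_space \<Rightarrow> complex"
  assumes "integrable lborel F"
  shows "integrable lborel (\<lambda>\<xi>. cis (x \<bullet> \<xi>) * F \<xi>)"
  by (rule Bochner_Integration.integrable_bound[OF assms])
     (use borel_measurable_integrable[OF assms] in \<open>auto simp: norm_mult\<close>)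

lemma inv_fourier_measurable [measurable]:
  fixes F :: "'a::euclidean_space \<Rightarrow> complex"
  assumes [measurable]: "F \<in> borel_measurable borel"
  shows "inv_fourier F \<in> borel_measurable borel"
proof -
  have "(\<lambda>x. LINT \<xi>|lborel. cis (x \<bullet> \<xi>) * F \<xi>) \<in> borel_measurable (borel :: 'a measure)"
    by (intro lborel.borel_measurable_lebesgue_integral) measurable
  then show ?thesis unfolding inv_fourier_def by measurable
qed

lemma inv_fourier_diff:
  assumes "integrable lborel F" "integrable lborel H"
  shows "inv_fourier (\<lambda>\<xi>. F \<xi> - H \<xi>) x = inv_fourier F x - inv_fourier H x"
  by (simp add: inv_fourier_def right_diff_distrib integrable_cis_mult assms)

lemma inv_fourier_mult_swap:
  fixes F \<phi> :: "'a::euclidean_space \<Rightarrow> complex"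
  assumes F: "integrable lborel F" and \<phi>: "integrable lborel \<phi>"
  shows "(LINT \<xi>|lborel. F \<xi> * inv_fourier \<phi> \<xi>) = (LINT x|lborel. inv_fourier F x * \<phi> x)"
proof -
  let ?c = "complex_of_real ((2 * pi) powr (- real DIM('a) / 2))"
  note [measurable] = borel_measurable_integrable[OF F] borel_measurable_integrable[OF \<phi>]
  have int: "integrable (lborel \<Otimes>\<^sub>M lborel) (case_prod (\<lambda>\<xi> x. ?c * (cis (x \<bullet> \<xi>) * (F \<xi> * \<phi> x))))"
    unfolding case_prod_unfold
    by (intro integrable_mult_right
        Bochner_Integration.integrable_bound[OF lborel_pair.integrable_mult_product[OF F \<phi>]])
       (auto simp: norm_mult)
  have l: "(LINT x|lborel. ?c * (cis (x \<bullet> \<xi>) * (F \<xi> * \<phi> x))) = F \<xi> * inv_fourier \<phi> \<xi>" for \<xi>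
  proof -
    have "(LINT x|lborel. ?c * (cis (x \<bullet> \<xi>) * (F \<xi> * \<phi> x))) =
        (LINT x|lborel. (?c * F \<xi>) * (cis (\<xi> \<bullet> x) * \<phi> x))"
      by (intro Bochner_Integration.integral_cong) (auto simp: mult_ac inner_commute)
    also have "\<dots> = (?c * F \<xi>) * (LINT x|lborel. cis (\<xi> \<bullet> x) * \<phi> x)"
      by (rule integral_mult_right_zero)
    finally show ?thesis by (simp only: inv_fourier_def mult_ac)
  qed
  have r: "(LINT \<xi>|lborel. ?c * (cis (x \<bullet> \<xi>) * (F \<xi> * \<phi> x))) = inv_fourier F x * \<phi> x" for x
  proof -
    have "(LINT \<xi>|lborel. ?c * (cis (x \<bullet> \<xi>) * (F \<xi> * \<phi> x))) =
        (LINT \<xi>|lborel. (?c * \<phi> x) * (cis (x \<bullet> \<xi>) * F \<xi>))"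
      by (intro Bochner_Integration.integral_cong) (auto simp: mult_ac)
    also have "\<dots> = (?c * \<phi> x) * (LINT \<xi>|lborel. cis (x \<bullet> \<xi>) * F \<xi>)"
      by (rule integral_mult_right_zero)
    finally show ?thesis by (simp only: inv_fourier_def mult_ac)
  qed
  show ?thesis
    using lborel_pair.Fubini_integral[OF int] unfolding l r by simp
qed

text \<open>The square of the modulus is a double integral in which the point \<open>x\<close> enters only through
  the phase difference; integrating in \<open>x\<close> against a weight thus replaces the phase by the
  transform of the weight at \<open>\<xi> - \<eta>\<close>.\<close>

lemma norm_inv_fourier_sq:
  fixes F :: "'a::euclidean_space \<Rightarrow> complex"
  assumes F: "integrable lborel F"
  shows "complex_of_real ((norm (inv_fourier F x))\<^sup>2) = complex_of_real (1 / (2 * pi) ^ DIM('a)) *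
    (LINT p|(lborel \<Otimes>\<^sub>M lborel). cis (x \<bullet> (fst p - snd p)) * (F (fst p) * cnj (F (snd p))))"
proof -
  let ?c = "(2 * pi) powr (- real DIM('a) / 2)"
  have c: "?c * ?c = 1 / (2 * pi) ^ DIM('a)"
    by (simp flip: powr_add) (simp add: powr_minus powr_realpow divide_inverse)
  have cnj_int: "integrable lborel (\<lambda>\<eta>. cnj (cis (x \<bullet> \<eta>) * F \<eta>))"
    using integrable_cis_mult[OF F] by (simp only: complex_integrable_cnj)
  have cis_diff: "cis (x \<bullet> (\<xi> - \<eta>)) = cis (x \<bullet> \<xi>) * cnj (cis (x \<bullet> \<eta>))" for \<xi> \<eta>
    by (simp add: inner_diff_right cis_cnj cis_mult)
  have "complex_of_real ((norm (inv_fourier F x))\<^sup>2) = inv_fourier F x * cnj (inv_fourier F x)"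
    by (rule complex_norm_square)
  also have "\<dots> = complex_of_real (?c * ?c) *
      ((LINT \<xi>|lborel. cis (x \<bullet> \<xi>) * F \<xi>) * (LINT \<eta>|lborel. cnj (cis (x \<bullet> \<eta>) * F \<eta>)))"
    unfolding Bochner_Integration.integral_cnj[of lborel "\<lambda>\<eta>. cis (x \<bullet> \<eta>) * F \<eta>"] inv_fourier_def
    by (simp only: complex_cnj_mult complex_cnj_complex_of_real of_real_mult mult_ac)
  also have "\<dots> = complex_of_real (1 / (2 * pi) ^ DIM('a)) *
      (LINT p|(lborel \<Otimes>\<^sub>M lborel). (cis (x \<bullet> fst p) * F (fst p)) * cnj (cis (x \<bullet> snd p) * F (snd p)))"
    unfolding c lborel_pair.integral_mult_product[OF integrable_cis_mult[OF F] cnj_int] ..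
  also have "(\<lambda>p. (cis (x \<bullet> fst p) * F (fst p)) * cnj (cis (x \<bullet> snd p) * F (snd p))) =
      (\<lambda>p. cis (x \<bullet> (fst p - snd p)) * (F (fst p) * cnj (F (snd p))))"
    unfolding cis_diff by (simp only: complex_cnj_mult mult_ac)
  finally show ?thesis .
qed


text \<open>With the Gaussian cutoff as weight, Fubini's theorem turns the left-hand side into
  \<open>\<integral>\<integral> N (\<xi> - \<eta>) F(\<xi>) cnj F(\<eta>)\<close> with a nonnegative kernel \<open>N\<close> of total mass one. The
  arithmetic-geometric mean inequality \<open>|F(\<xi>) F(\<eta>)| \<le> (|F(\<xi>)|\<^sup>2 + |F(\<eta>)|\<^sup>2) / 2\<close> then
  decouples the variables, and the kernel integrates to one in either of them. The normalising
  factor \<open>1 / (2 * pi) ^ n\<close> of the squared transform is what makes the mass equal to one.\<close>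

lemma gauss_weighted_Plancherel_le:
  fixes F :: "'a::euclidean_space \<Rightarrow> complex"
  assumes F: "integrable lborel F" and \<sigma>: "\<sigma> > 0"
  shows "(\<integral>\<^sup>+x. gauss_cutoff \<sigma> x * (norm (inv_fourier F x))\<^sup>2 \<partial>lborel) \<le>
    (\<integral>\<^sup>+\<xi>. (norm (F \<xi>))\<^sup>2 \<partial>lborel)"
proof -
  note [measurable] = borel_measurable_integrable[OF F]
  let ?d = "complex_of_real (1 / (2 * pi) ^ DIM('a))"
  let ?H = "\<lambda>p. F (fst p) * cnj (F (snd p))"
  let ?w = "\<lambda>x. gauss_cutoff \<sigma> x * (norm (inv_fourier F x))\<^sup>2"
  let ?N = "gauss_kernel (1 / \<sigma>) :: 'a \<Rightarrow> real"
  let ?P = "lborel \<Otimes>\<^sub>M lborel :: ('a \<times> 'a) measure"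
  interpret pp: pair_sigma_finite "lborel :: 'a measure" ?P
    by (intro pair_sigma_finite.intro lborel.sigma_finite_measure_axioms
        lborel_pair.sigma_finite_measure_axioms sigma_finite_pair_measure)
  have H: "integrable ?P ?H"
    using F by (intro lborel_pair.integrable_mult_product) (auto simp: complex_integrable_cnj)
  have g: "integrable lborel (\<lambda>x::'a. complex_of_real (gauss_cutoff \<sigma> x))"
    using gauss_cutoff_integrable[OF \<sigma>] by (simp only: complex_of_real_integrable_eq)
  have int: "integrable (lborel \<Otimes>\<^sub>M ?P) (case_prod (\<lambda>x p. ?d * (cis (x \<bullet> (fst p - snd p)) *
      (complex_of_real (gauss_cutoff \<sigma> x) * ?H p))))"
    unfolding case_prod_unfold
  proof (intro integrable_mult_right Bochner_Integration.integrable_bound[OF pp.integrable_mult_product[OF g H]])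
    show "(\<lambda>q. cis (fst q \<bullet> (fst (snd q) - snd (snd q))) * (complex_of_real (gauss_cutoff \<sigma> (fst q)) * ?H (snd q)))
        \<in> borel_measurable (lborel \<Otimes>\<^sub>M ?P)" by measurable
  qed (auto simp: norm_mult)
  have l: "(LINT p|?P. ?d * (cis (x \<bullet> (fst p - snd p)) * (complex_of_real (gauss_cutoff \<sigma> x) * ?H p))) =
      complex_of_real (?w x)" for x
  proof -
    have "(LINT p|?P. ?d * (cis (x \<bullet> (fst p - snd p)) * (complex_of_real (gauss_cutoff \<sigma> x) * ?H p))) =
       (LINT p|?P. (?d * complex_of_real (gauss_cutoff \<sigma> x)) * (cis (x \<bullet> (fst p - snd p)) * ?H p))"
      by (intro Bochner_Integration.integral_cong) (auto simp: mult_ac)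
    also have "\<dots> = (?d * complex_of_real (gauss_cutoff \<sigma> x)) * (LINT p|?P. cis (x \<bullet> (fst p - snd p)) * ?H p)"
      by (rule integral_mult_right_zero)
    also have "\<dots> = complex_of_real (gauss_cutoff \<sigma> x) * complex_of_real ((norm (inv_fourier F x))\<^sup>2)"
      unfolding norm_inv_fourier_sq[OF F] by (simp only: mult_ac)
    finally show ?thesis by (simp only: of_real_mult)
  qed
  have r: "(LINT x|lborel. ?d * (cis (x \<bullet> (fst p - snd p)) * (complex_of_real (gauss_cutoff \<sigma> x) * ?H p))) =
      complex_of_real (?N (fst p - snd p)) * ?H p" for p
  proof -
    have "(LINT x|lborel. ?d * (cis (x \<bullet> (fst p - snd p)) * (complex_of_real (gauss_cutoff \<sigma> x) * ?H p))) =
       (LINT x|lborel. (?d * ?H p) * (complex_of_real (gauss_cutoff \<sigma> x) * cis (x \<bullet> (fst p - snd p))))"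
      by (intro Bochner_Integration.integral_cong) (auto simp: mult_ac)
    also have "\<dots> = (?d * ?H p) * complex_of_real ((2 * pi) ^ DIM('a) * ?N (fst p - snd p))"
      by (simp only: integral_mult_right_zero gauss_cutoff_transform[OF \<sigma>])
    finally show ?thesis by simp
  qed
  have eq: "(LINT x|lborel. complex_of_real (?w x)) = (LINT p|?P. complex_of_real (?N (fst p - snd p)) * ?H p)"
    using pp.Fubini_integral[OF int] unfolding l r by simp
  have w_int: "integrable lborel ?w"
    using pp.integrable_fst[OF int] unfolding l by (simp only: complex_of_real_integrable_eq)
  have w_nonneg: "?w x \<ge> 0" for x
    using gauss_cutoff_nonneg by (intro mult_nonneg_nonneg) auto
  have NH: "integrable ?P (\<lambda>p. complex_of_real (?N (fst p - snd p)) * ?H p)"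
    using pp.integrable_snd[OF int] unfolding r .
  have "(\<integral>\<^sup>+x. ?w x \<partial>lborel) = ennreal (LINT x|lborel. ?w x)"
    using w_int w_nonneg by (intro nn_integral_eq_integral) auto
  also have "(LINT x|lborel. ?w x) = norm (LINT x|lborel. complex_of_real (?w x))"
    using w_nonneg by (simp only: integral_complex_of_real norm_of_real) (simp add: integral_nonneg_AE)
  also have "ennreal \<dots> \<le> (\<integral>\<^sup>+p. norm (complex_of_real (?N (fst p - snd p)) * ?H p) \<partial>?P)"
    unfolding eq by (intro integral_norm_bound_ennreal NH)
  also have "\<dots> \<le> (\<integral>\<^sup>+p. ennreal (?N (fst p - snd p)) * ennreal ((norm (F (fst p)))\<^sup>2 / 2) +
      ennreal (?N (snd p - fst p)) * ennreal ((norm (F (snd p)))\<^sup>2 / 2) \<partial>?P)"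
  proof (rule nn_integral_mono)
    fix p :: "'a \<times> 'a"
    have "norm (F (fst p)) * norm (F (snd p)) \<le> (norm (F (fst p)))\<^sup>2 / 2 + (norm (F (snd p)))\<^sup>2 / 2"
      using sum_squares_bound[of "norm (F (fst p))" "norm (F (snd p))"] by simp
    then have "?N (fst p - snd p) * (norm (F (fst p)) * norm (F (snd p))) \<le>
        ?N (fst p - snd p) * ((norm (F (fst p)))\<^sup>2 / 2 + (norm (F (snd p)))\<^sup>2 / 2)"
      by (intro mult_left_mono gauss_kernel_nonneg)
    then have "norm (complex_of_real (?N (fst p - snd p)) * ?H p) \<le>
        ?N (fst p - snd p) * ((norm (F (fst p)))\<^sup>2 / 2) + ?N (snd p - fst p) * ((norm (F (snd p)))\<^sup>2 / 2)"
      using gauss_kernel_nonneg[of "1 / \<sigma>" "fst p - snd p"] gauss_kernel_minus_commute[of "1 / \<sigma>" "snd p" "fst p"]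
      by (simp add: norm_mult distrib_left)
    have split: "ennreal (?N z) * ennreal (r\<^sup>2 / 2) = ennreal (?N z * (r\<^sup>2 / 2))" for z r
      by (rule ennreal_mult[symmetric]) (auto simp: gauss_kernel_nonneg)
    have "ennreal (norm (complex_of_real (?N (fst p - snd p)) * ?H p)) \<le>
        ennreal (?N (fst p - snd p) * ((norm (F (fst p)))\<^sup>2 / 2) + ?N (snd p - fst p) * ((norm (F (snd p)))\<^sup>2 / 2))"
      by (rule ennreal_leI) fact
    then show "ennreal (norm (complex_of_real (?N (fst p - snd p)) * ?H p)) \<le>
        ennreal (?N (fst p - snd p)) * ennreal ((norm (F (fst p)))\<^sup>2 / 2) +
        ennreal (?N (snd p - fst p)) * ennreal ((norm (F (snd p)))\<^sup>2 / 2)"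
      unfolding split by (subst ennreal_plus[symmetric]) (auto intro!: mult_nonneg_nonneg gauss_kernel_nonneg)
  qed
  also have "\<dots> = (\<integral>\<^sup>+p. ennreal (?N (fst p - snd p)) * ennreal ((norm (F (fst p)))\<^sup>2 / 2) \<partial>?P) +
     (\<integral>\<^sup>+p. ennreal (?N (snd p - fst p)) * ennreal ((norm (F (snd p)))\<^sup>2 / 2) \<partial>?P)"
    by (intro nn_integral_add) measurable
  also have "(\<integral>\<^sup>+p. ennreal (?N (fst p - snd p)) * ennreal ((norm (F (fst p)))\<^sup>2 / 2) \<partial>?P) =
      (\<integral>\<^sup>+\<xi>. \<integral>\<^sup>+\<eta>. ennreal (?N (\<eta> - \<xi>)) * ennreal ((norm (F \<xi>))\<^sup>2 / 2) \<partial>lborel \<partial>lborel)"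
    by (subst lborel.nn_integral_fst[symmetric]) (auto simp: gauss_kernel_minus_commute)
  also have "\<dots> = (\<integral>\<^sup>+\<xi>. ennreal ((norm (F \<xi>))\<^sup>2 / 2) \<partial>lborel)"
    using \<sigma> by (simp add: nn_integral_multc gauss_kernel_nn_integral)
  also have "(\<integral>\<^sup>+p. ennreal (?N (snd p - fst p)) * ennreal ((norm (F (snd p)))\<^sup>2 / 2) \<partial>?P) =
      (\<integral>\<^sup>+\<eta>. \<integral>\<^sup>+\<xi>. ennreal (?N (\<xi> - \<eta>)) * ennreal ((norm (F \<eta>))\<^sup>2 / 2) \<partial>lborel \<partial>lborel)"
    by (subst lborel_pair.nn_integral_snd[symmetric]) (auto simp: gauss_kernel_minus_commute)
  also have "\<dots> = (\<integral>\<^sup>+\<xi>. ennreal ((norm (F \<xi>))\<^sup>2 / 2) \<partial>lborel)"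
    using \<sigma> by (simp add: nn_integral_multc gauss_kernel_nn_integral)
  also have "(\<integral>\<^sup>+\<xi>. ennreal ((norm (F \<xi>))\<^sup>2 / 2) \<partial>lborel) + (\<integral>\<^sup>+\<xi>. ennreal ((norm (F \<xi>))\<^sup>2 / 2) \<partial>lborel) =
      (\<integral>\<^sup>+\<xi>. (norm (F \<xi>))\<^sup>2 \<partial>lborel)"
    by (subst nn_integral_add[symmetric]) (auto simp flip: ennreal_plus)
  finally show ?thesis .
qed

text \<open>The cutoff is removed by Fatou's lemma.\<close>

lemma Plancherel_le:
  fixes F :: "'a::euclidean_space \<Rightarrow> complex"
  assumes F: "integrable lborel F"
  shows "(\<integral>\<^sup>+x. (norm (inv_fourier F x))\<^sup>2 \<partial>lborel) \<le> (\<integral>\<^sup>+\<xi>. (norm (F \<xi>))\<^sup>2 \<partial>lborel)"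
proof (rule Fatou_bound)
  note [measurable] = borel_measurable_integrable[OF F]
  show "(\<lambda>x. ennreal (gauss_cutoff (real (Suc k)) x * (norm (inv_fourier F x))\<^sup>2)) \<in> borel_measurable lborel" for k
    by measurable
  show "AE x in lborel. (\<lambda>k. ennreal (gauss_cutoff (real (Suc k)) x * (norm (inv_fourier F x))\<^sup>2))
      \<longlonglongrightarrow> ennreal ((norm (inv_fourier F x))\<^sup>2)"
    using tendsto_mult_right[OF gauss_cutoff_tendsto_1]
    by (intro AE_I2 tendsto_ennrealI) fastforce
  show "\<forall>\<^sub>F k in sequentially. (\<integral>\<^sup>+x. gauss_cutoff (real (Suc k)) x * (norm (inv_fourier F x))\<^sup>2 \<partial>lborel)
      \<le> (\<integral>\<^sup>+\<xi>. (norm (F \<xi>))\<^sup>2 \<partial>lborel)"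
    by (intro always_eventually allI gauss_weighted_Plancherel_le F) simp
qed

section \<open>Limits in the space of square integrable functions\<close>

text \<open>This is the core of the Riesz--Fischer theorem. The weights \<open>2 ^ k\<close> are chosen so that the
  weighted squares of the increments still have a finite integral, while
  \<open>d \<le> (1 / 2) ^ k + 2 ^ k * d\<^sup>2\<close> makes the increments themselves absolutely
  summable at almost every point.\<close>

lemma AE_convergent_of_fast_L2_Cauchy:
  fixes f :: "nat \<Rightarrow> 'a \<Rightarrow> complex"
  assumes [measurable]: "\<And>k. f k \<in> borel_measurable M"
    and close: "\<And>k. (\<integral>\<^sup>+x. (norm (f (Suc k) x - f k x))\<^sup>2 \<partial>M) \<le> ennreal (2 * (1 / 4) ^ k)"
  shows "AE x in M. convergent (\<lambda>k. f k x)"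
proof -
  let ?a = "\<lambda>k x. 2 ^ k * (norm (f (Suc k) x - f k x))\<^sup>2"
  have "(\<integral>\<^sup>+x. (\<Sum>k. ennreal (?a k x)) \<partial>M) = (\<Sum>k. \<integral>\<^sup>+x. ennreal (?a k x) \<partial>M)"
    by (intro nn_integral_suminf) measurable
  also have "\<dots> \<le> (\<Sum>k. ennreal (2 * (1 / 2) ^ k))"
  proof (intro suminf_le allI)
    fix k
    have "(\<integral>\<^sup>+x. ennreal (?a k x) \<partial>M) = ennreal (2 ^ k) * (\<integral>\<^sup>+x. (norm (f (Suc k) x - f k x))\<^sup>2 \<partial>M)"
      by (simp add: ennreal_mult nn_integral_cmult)
    also have "\<dots> \<le> ennreal (2 ^ k) * ennreal (2 * (1 / 4) ^ k)"
      by (intro mult_left_mono close) simp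
    also have "\<dots> = ennreal (2 ^ k * (2 * (1 / 4) ^ k))" by (simp add: ennreal_mult)
    also have "(2 ^ k * (2 * (1 / 4) ^ k) :: real) = 2 * (1 / 2) ^ k"
      by (simp flip: power_mult_distrib)
    finally show "(\<integral>\<^sup>+x. ennreal (?a k x) \<partial>M) \<le> ennreal (2 * (1 / 2) ^ k)" .
  qed auto
  also have "\<dots> = ennreal (\<Sum>k. 2 * (1 / 2) ^ k)"
    by (intro suminf_ennreal2) (auto intro!: summable_mult summable_geometric)
  also have "\<dots> < \<infinity>" by simp
  finally have "AE x in M. (\<Sum>k. ennreal (?a k x)) \<noteq> \<infinity>"
    by (intro nn_integral_PInf_AE) auto
  then show ?thesis
  proof (rule eventually_mono)
    fix x assume "(\<Sum>k. ennreal (?a k x)) \<noteq> \<infinity>"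
    then have a: "summable (\<lambda>k. ?a k x)"
      by (intro summable_suminf_not_top) auto
    have "summable (\<lambda>k. f (Suc k) x - f k x)"
    proof (rule summable_comparison_test')
      show "summable (\<lambda>k. (1 / 2) ^ k + ?a k x)"
        by (intro summable_add a summable_geometric) simp
      show "norm (f (Suc k) x - f k x) \<le> (1 / 2) ^ k + ?a k x" for k
      proof -
        let ?d = "norm (f (Suc k) x - f k x)"
        have "2 * ?d \<le> p * ?d\<^sup>2 + 1 / p" if "p > 0" for p :: real
        proof -
          have "0 \<le> p * (?d - 1 / p)\<^sup>2" using that by simp
          also have "\<dots> = p * ?d\<^sup>2 + 1 / p - 2 * ?d"
            using that by (simp add: power2_diff field_simps power2_eq_square)
          finally show ?thesis by simp
        qed
        from this[of "2 ^ k"] have "2 * ?d \<le> ?a k x + (1 / 2) ^ k"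
          by (simp add: power_one_over)
        then show ?thesis by (smt (verit) norm_ge_zero)
      qed
    qed
    from tendsto_add[OF tendsto_const[of "f 0 x"] summable_LIMSEQ[OF this]]
    have "(\<lambda>n. f n x) \<longlonglongrightarrow> f 0 x + (\<Sum>k. f (Suc k) x - f k x)"
      by (simp add: sum_lessThan_telescope[of "\<lambda>k. f k x"])
    then show "convergent (\<lambda>k. f k x)" by (rule convergentI)
  qed
qed

text \<open>The inequality
  \<open>|z w| \<le> c |z|\<^sup>2 + |w|\<^sup>2 / c\<close> with \<open>c = 2 ^ k\<close> takes the place of the
  Cauchy--Schwarz inequality; the geometric rate pays for the growing factor.\<close>

lemma integral_tendsto_of_L2_close:
  fixes h :: "nat \<Rightarrow> 'a \<Rightarrow> complex"
  assumes [measurable]: "\<And>k. h k \<in> borel_measurable M" "h' \<in> borel_measurable M" "\<phi> \<in> borel_measurable M"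
    and close: "\<And>k. (\<integral>\<^sup>+x. (norm (h k x - h' x))\<^sup>2 \<partial>M) \<le> ennreal (2 * (1 / 4) ^ k)"
    and h': "integrable M (\<lambda>x. (norm (h' x))\<^sup>2)" and \<phi>: "integrable M (\<lambda>x. (norm (\<phi> x))\<^sup>2)"
  shows "(\<lambda>k. LINT x|M. h k x * \<phi> x) \<longlonglongrightarrow> (LINT x|M. h' x * \<phi> x)"
proof (rule tendsto_L1_int)
  have amgm: "norm (z * w) \<le> c * (norm z)\<^sup>2 + (norm w)\<^sup>2 / c" if "c > 0" for z w :: complex and c :: real
  proof -
    have "2 * norm (z * w) \<le> c * (norm z)\<^sup>2 + (norm w)\<^sup>2 / c"
      using that zero_le_power2[of "c * norm z - norm w"]
      by (simp add: norm_mult power2_diff power_mult_distrib field_simps power2_eq_square)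
    then show ?thesis by (smt (verit) norm_ge_zero)
  qed
  show int': "integrable M (\<lambda>x. h' x * \<phi> x)"
    using h' \<phi> amgm[of 1] by (intro Bochner_Integration.integrable_bound[OF Bochner_Integration.integrable_add[OF h' \<phi>]]) auto
  define A where "A = (LINT x|M. (norm (\<phi> x))\<^sup>2)"
  have A: "(\<integral>\<^sup>+x. (norm (\<phi> x))\<^sup>2 \<partial>M) = ennreal A" "A \<ge> 0"
    unfolding A_def using \<phi> by (auto intro!: nn_integral_eq_integral)
  have bound: "(\<integral>\<^sup>+x. norm (h k x * \<phi> x - h' x * \<phi> x) \<partial>M) \<le> ennreal ((2 + A) * (1 / 2) ^ k)" for k
  proof -
    have "(\<integral>\<^sup>+x. norm (h k x * \<phi> x - h' x * \<phi> x) \<partial>M) \<le>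
       (\<integral>\<^sup>+x. ennreal (2 ^ k) * (norm (h k x - h' x))\<^sup>2 + ennreal ((1 / 2) ^ k) * (norm (\<phi> x))\<^sup>2 \<partial>M)"
    proof (rule nn_integral_mono)
      fix x
      have "norm (h k x * \<phi> x - h' x * \<phi> x) \<le> 2 ^ k * (norm (h k x - h' x))\<^sup>2 + (1 / 2) ^ k * (norm (\<phi> x))\<^sup>2"
        using amgm[of "2 ^ k" "h k x - h' x" "\<phi> x"] by (simp add: left_diff_distrib power_one_over field_simps)
      then show "ennreal (norm (h k x * \<phi> x - h' x * \<phi> x)) \<le>
          ennreal (2 ^ k) * (norm (h k x - h' x))\<^sup>2 + ennreal ((1 / 2) ^ k) * (norm (\<phi> x))\<^sup>2"
        by (simp flip: ennreal_mult ennreal_plus add: ennreal_leI)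
    qed
    also have "\<dots> = ennreal (2 ^ k) * (\<integral>\<^sup>+x. (norm (h k x - h' x))\<^sup>2 \<partial>M) + ennreal ((1 / 2) ^ k) * ennreal A"
      by (simp add: nn_integral_add nn_integral_cmult A)
    also have "\<dots> \<le> ennreal (2 ^ k) * ennreal (2 * (1 / 4) ^ k) + ennreal ((1 / 2) ^ k) * ennreal A"
      by (intro add_mono mult_left_mono close) auto
    also have "\<dots> = ennreal (2 ^ k * (2 * (1 / 4) ^ k) + (1 / 2) ^ k * A)"
      using A by (simp add: ennreal_mult)
    also have "2 ^ k * (2 * (1 / 4) ^ k) + (1 / 2) ^ k * A = (2 + A) * (1 / 2) ^ k"
      by (simp add: algebra_simps flip: power_mult_distrib)
    finally show ?thesis .
  qed
  show "integrable M (\<lambda>x. h k x * \<phi> x)" for k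
  proof -
    have "integrable M (\<lambda>x. h k x * \<phi> x - h' x * \<phi> x)"
      using bound[of k] by (intro integrableI_bounded) (auto intro: le_less_trans)
    from Bochner_Integration.integrable_add[OF this int'] show ?thesis by simp
  qed
  show "((\<lambda>k. \<integral>\<^sup>+x. norm (h k x * \<phi> x - h' x * \<phi> x) \<partial>M) \<longlongrightarrow> 0) sequentially"
  proof (rule tendsto_sandwich[OF _ _ tendsto_const])
    have "(\<lambda>k. (2 + A) * (1 / 2) ^ k) \<longlonglongrightarrow> (2 + A) * 0"
      by (intro tendsto_mult tendsto_const LIMSEQ_realpow_zero) auto
    then show "(\<lambda>k. ennreal ((2 + A) * (1 / 2) ^ k)) \<longlonglongrightarrow> 0"
      using tendsto_ennrealI by fastforce
  qed (use bound in auto)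
qed


section \<open>Integrability of Schwartz functions\<close>

lemma integrable_inverse_prod_1_plus_square:
  "integrable lborel (\<lambda>x::'a::euclidean_space. \<Prod>b\<in>Basis. inverse (1 + (x \<bullet> b)\<^sup>2))"
proof -
  have "integrable lborel (\<lambda>x::real. inverse (1 + x\<^sup>2))"
    using integrable_inverse_1_plus_square by (simp add: set_integrable_def)
  then have "integrable lborel (\<lambda>x::real. complex_of_real (inverse (1 + x\<^sup>2)))"
    by (simp only: complex_of_real_integrable_eq)
  from lborel_integral_prod(1)[of "\<lambda>_ x. complex_of_real (inverse (1 + x\<^sup>2))", OF this]
  have "integrable lborel (\<lambda>x::'a. complex_of_real (\<Prod>b\<in>Basis. inverse (1 + (x \<bullet> b)\<^sup>2)))"
    by (simp only: of_real_prod)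
  then show ?thesis by (simp only: complex_of_real_integrable_eq)
qed

text \<open>Decay of order \<open>2 * DIM('a)\<close> dominates the product of the one-dimensional weights
  \<open>1 + (x \<bullet> b)\<^sup>2\<close>, whose reciprocal is integrable.\<close>

lemma schwartz_integrable:
  fixes \<phi> :: "'a::euclidean_space \<Rightarrow> complex"
  assumes "schwartz \<phi>"
  shows "integrable lborel \<phi>" and "integrable lborel (\<lambda>x. (norm (\<phi> x))\<^sup>2)"
proof -
  let ?n = "DIM('a)"
  have "\<phi> differentiable_on UNIV" and bdd: "\<And>k. bounded (range (\<lambda>x. norm x ^ k *\<^sub>R \<phi> x))"
    using assms[unfolded schwartz_def, rule_format, of "[]"] by auto
  then have "continuous_on UNIV \<phi>"
    by (intro differentiable_imp_continuous_on)
  then have [measurable]: "\<phi> \<in> borel_measurable borel"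
    by (rule borel_measurable_continuous_onI)
  obtain A where A: "norm (\<phi> x) \<le> A" for x
    using bdd[of 0] by (auto simp: bounded_iff)
  obtain B where B: "norm x ^ (2 * ?n) * norm (\<phi> x) \<le> B" for x
    using bdd[of "2 * ?n"] by (auto simp: bounded_iff)
  let ?D = "\<lambda>x::'a. \<Prod>b\<in>Basis. 1 + (x \<bullet> b)\<^sup>2"
  have D: "?D x * norm (\<phi> x) \<le> 2 ^ ?n * (A + B)" for x
  proof -
    have "?D x \<le> (\<Prod>b\<in>(Basis::'a set). 1 + (norm x)\<^sup>2)"
    proof (rule prod_mono)
      fix b :: 'a assume "b \<in> Basis"
      then have "\<bar>x \<bullet> b\<bar>\<^sup>2 \<le> (norm x)\<^sup>2" by (intro power_mono Basis_le_norm) auto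
      then show "0 \<le> 1 + (x \<bullet> b)\<^sup>2 \<and> 1 + (x \<bullet> b)\<^sup>2 \<le> 1 + (norm x)\<^sup>2" by simp
    qed
    also have "\<dots> = (1 + (norm x)\<^sup>2) ^ ?n" by simp
    also have "\<dots> \<le> (2 * max 1 ((norm x)\<^sup>2)) ^ ?n"
      by (intro power_mono) auto
    also have "\<dots> = 2 ^ ?n * max 1 ((norm x)\<^sup>2) ^ ?n"
      by (rule power_mult_distrib)
    also have "\<dots> \<le> 2 ^ ?n * (1 + norm x ^ (2 * ?n))"
      by (intro mult_left_mono) (auto simp: max_def power_mult)
    finally have "?D x * norm (\<phi> x) \<le> 2 ^ ?n * (1 + norm x ^ (2 * ?n)) * norm (\<phi> x)"
      by (intro mult_right_mono) auto
    also have "\<dots> = 2 ^ ?n * (norm (\<phi> x) + norm x ^ (2 * ?n) * norm (\<phi> x))"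
      by (simp add: algebra_simps)
    also have "\<dots> \<le> 2 ^ ?n * (A + B)"
      by (intro mult_left_mono add_mono A B) auto
    finally show ?thesis .
  qed
  have D_pos: "?D x > 0" for x
    by (intro prod_pos) (auto intro: add_pos_nonneg)
  show int: "integrable lborel \<phi>"
  proof (rule Bochner_Integration.integrable_bound)
    show "integrable lborel (\<lambda>x::'a. 2 ^ ?n * (A + B) * (\<Prod>b\<in>Basis. inverse (1 + (x \<bullet> b)\<^sup>2)))"
      by (intro integrable_mult_right integrable_inverse_prod_1_plus_square)
    have "norm (\<phi> x) \<le> 2 ^ ?n * (A + B) * (\<Prod>b\<in>Basis. inverse (1 + (x \<bullet> b)\<^sup>2))" for x
      using D[of x] D_pos[of x] prod_inversef[of "\<lambda>b. 1 + (x \<bullet> b)\<^sup>2" Basis]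
      by (simp add: o_def field_simps)
    then show "AE x in lborel. norm (\<phi> x) \<le> norm (2 ^ ?n * (A + B) * (\<Prod>b\<in>Basis. inverse (1 + (x \<bullet> b)\<^sup>2)))"
      by (intro AE_I2) (auto intro: order.trans[OF _ abs_ge_self])
  qed simp
  show "integrable lborel (\<lambda>x. (norm (\<phi> x))\<^sup>2)"
  proof (rule Bochner_Integration.integrable_bound)
    show "integrable lborel (\<lambda>x. A * norm (\<phi> x))"
      using int by (intro integrable_mult_right integrable_norm)
    have "norm (\<phi> x) * norm (\<phi> x) \<le> A * norm (\<phi> x)" for x
      by (intro mult_right_mono A) auto
    then show "AE x in lborel. norm ((norm (\<phi> x))\<^sup>2) \<le> norm (A * norm (\<phi> x))"
      by (intro AE_I2) (auto simp: power2_eq_square intro: order.trans[OF _ abs_ge_self])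
  qed simp
qed

section \<open>Inverse Fourier transform of square integrable functions\<close>

text \<open>The integral defining the inverse transform may diverge for a square integrable \<open>F\<close>, but
  it converges for the truncations of \<open>F\<close> to balls. Along radii for which the truncations
  approach \<open>F\<close> geometrically fast, Plancherel's inequality makes their transforms a fast
  Cauchy sequence, and \<open>f\<close> is its limit. The bound on the norm and the duality relation hold
  for the truncations and pass to the limit, the latter because the transform of a Schwartz
  function is itself square integrable.\<close>

lemma square_integrable_inverse_transform:
  fixes F :: "'a::euclidean_space \<Rightarrow> complex"
  assumes F: "square_integrable F"
  obtains f where "square_integrable f" "L2norm f \<le> L2norm F"
    "\<And>\<phi>. schwartz \<phi> \<Longrightarrow> (LINT \<xi>|lborel. F \<xi> * inv_fourier \<phi> \<xi>) = (LINT x|lborel. f x * \<phi> x)"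
proof -
  have F_meas [measurable]: "F \<in> borel_measurable borel" and F2: "integrable lborel (\<lambda>\<xi>. (norm (F \<xi>))\<^sup>2)"
    using F by (auto simp: square_integrable_def)
  have F2_nn: "(\<integral>\<^sup>+\<xi>. (norm (F \<xi>))\<^sup>2 \<partial>lborel) = ennreal (LINT \<xi>|lborel. (norm (F \<xi>))\<^sup>2)"
    using F2 by (intro nn_integral_eq_integral) auto
  define T where "T = (\<lambda>n::nat. \<lambda>\<xi>. indicator (cball 0 (real n)) \<xi> *\<^sub>R F \<xi>)"
  have [measurable]: "T n \<in> borel_measurable borel" for n
    unfolding T_def by (intro borel_measurable_scaleR borel_measurable_indicator) (auto simp: F_meas)
  have T_int: "integrable lborel (T n)" for n
  proof (rule Bochner_Integration.integrable_bound)
    show "integrable lborel (\<lambda>\<xi>::'a. indicator (cball 0 (real n)) \<xi> + (norm (F \<xi>))\<^sup>2 :: real)"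
      using emeasure_lborel_cball_finite[of "0::'a" "real n"]
      by (intro Bochner_Integration.integrable_add F2 integrable_real_indicator) auto
    have "r \<le> 1 + r\<^sup>2" for r :: real
      using zero_le_power2[of "r - 1 / 2"] by (simp add: power2_diff field_simps)
    then show "AE \<xi> in lborel. norm (T n \<xi>) \<le> norm (indicator (cball 0 (real n)) \<xi> + (norm (F \<xi>))\<^sup>2 :: real)"
      by (intro AE_I2) (auto simp: T_def indicator_def)
  qed simp
  have "(\<lambda>n. \<integral>\<^sup>+\<xi>. (norm (T n \<xi> - F \<xi>))\<^sup>2 \<partial>lborel) \<longlonglongrightarrow> (\<integral>\<^sup>+(\<xi>::'a). 0 \<partial>lborel)"
  proof (rule nn_integral_dominated_convergence[where w = "\<lambda>\<xi>. ennreal ((norm (F \<xi>))\<^sup>2)"])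
    show "AE \<xi> in lborel. ennreal ((norm (T j \<xi> - F \<xi>))\<^sup>2) \<le> ennreal ((norm (F \<xi>))\<^sup>2)" for j
      by (intro AE_I2 ennreal_leI) (auto simp: T_def indicator_def)
    show "AE \<xi> in lborel. (\<lambda>n. ennreal ((norm (T n \<xi> - F \<xi>))\<^sup>2)) \<longlonglongrightarrow> 0"
    proof (rule AE_I2)
      fix \<xi> :: 'a
      obtain N where "norm \<xi> \<le> real N" using real_arch_simple by blast
      then have "T n \<xi> = F \<xi>" if "n \<ge> N" for n
        using that by (auto simp: T_def indicator_def)
      then show "(\<lambda>n. ennreal ((norm (T n \<xi> - F \<xi>))\<^sup>2)) \<longlonglongrightarrow> 0"
        by (intro tendsto_eventually) (auto simp: eventually_sequentially)
    qed
  qed (use F2_nn in auto)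
  then have lim: "(\<lambda>n. \<integral>\<^sup>+\<xi>. (norm (T n \<xi> - F \<xi>))\<^sup>2 \<partial>lborel) \<longlonglongrightarrow> 0" by simp
  have "\<exists>n. (\<integral>\<^sup>+\<xi>. (norm (T n \<xi> - F \<xi>))\<^sup>2 \<partial>lborel) < ennreal ((1 / 4) ^ k)" for k
    using order_tendstoD(2)[OF lim, of "ennreal ((1 / 4) ^ k)"] by (auto simp: eventually_sequentially)
  then obtain R where R: "(\<integral>\<^sup>+\<xi>. (norm (T (R k) \<xi> - F \<xi>))\<^sup>2 \<partial>lborel) < ennreal ((1 / 4) ^ k)" for k
    by metis
  define f where "f = (\<lambda>k. inv_fourier (T (R k)))"
  have [measurable]: "f k \<in> borel_measurable borel" for k
    unfolding f_def by measurable
  have close: "(\<integral>\<^sup>+x. (norm (f m x - f k x))\<^sup>2 \<partial>lborel) \<le> ennreal (2 * (1 / 4) ^ k)" if "k \<le> m" for k m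
  proof -
    have "(\<integral>\<^sup>+x. (norm (f m x - f k x))\<^sup>2 \<partial>lborel) \<le> (\<integral>\<^sup>+\<xi>. (norm (T (R m) \<xi> - T (R k) \<xi>))\<^sup>2 \<partial>lborel)"
      unfolding f_def inv_fourier_diff[OF T_int T_int, symmetric]
      by (intro Plancherel_le Bochner_Integration.integrable_diff T_int)
    also have "\<dots> \<le> (\<integral>\<^sup>+\<xi>. ennreal ((norm (T (R m) \<xi> - F \<xi>))\<^sup>2) + ennreal ((norm (T (R k) \<xi> - F \<xi>))\<^sup>2) \<partial>lborel)"
      by (intro nn_integral_mono) (auto simp: T_def indicator_def simp flip: ennreal_plus)
    also have "\<dots> = (\<integral>\<^sup>+\<xi>. (norm (T (R m) \<xi> - F \<xi>))\<^sup>2 \<partial>lborel) + (\<integral>\<^sup>+\<xi>. (norm (T (R k) \<xi> - F \<xi>))\<^sup>2 \<partial>lborel)"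
      by (intro nn_integral_add) measurable
    also have "\<dots> \<le> ennreal ((1 / 4) ^ m) + ennreal ((1 / 4) ^ k)"
      by (intro add_mono less_imp_le R)
    also have "\<dots> \<le> ennreal (2 * (1 / 4) ^ k)"
      using power_decreasing[OF that, of "1 / 4 :: real"]
      by (simp flip: ennreal_plus add: ennreal_leI)
    finally show ?thesis .
  qed
  have conv: "AE x in lborel. convergent (\<lambda>k. f k x)"
    using close[of k "Suc k" for k] by (intro AE_convergent_of_fast_L2_Cauchy) auto
  define f' where "f' = (\<lambda>x. lim (\<lambda>k. f k x))"
  have [measurable]: "f' \<in> borel_measurable borel"
    unfolding f'_def by measurable
  have f_lim: "AE x in lborel. (\<lambda>k. f k x) \<longlonglongrightarrow> f' x"
    using conv by (rule eventually_mono) (simp add: f'_def convergent_LIMSEQ_iff)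
  have bound: "(\<integral>\<^sup>+x. (norm (f' x))\<^sup>2 \<partial>lborel) \<le> (\<integral>\<^sup>+\<xi>. (norm (F \<xi>))\<^sup>2 \<partial>lborel)"
  proof (rule Fatou_bound[where u = "\<lambda>k x. ennreal ((norm (f k x))\<^sup>2)"])
    show "AE x in lborel. (\<lambda>k. ennreal ((norm (f k x))\<^sup>2)) \<longlonglongrightarrow> ennreal ((norm (f' x))\<^sup>2)"
      using f_lim by (rule eventually_mono) (intro tendsto_intros)
    have "(\<integral>\<^sup>+x. (norm (f k x))\<^sup>2 \<partial>lborel) \<le> (\<integral>\<^sup>+\<xi>. (norm (T (R k) \<xi>))\<^sup>2 \<partial>lborel)" for k
      unfolding f_def by (intro Plancherel_le T_int)
    also have "\<dots> k \<le> (\<integral>\<^sup>+\<xi>. (norm (F \<xi>))\<^sup>2 \<partial>lborel)" for k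
      by (intro nn_integral_mono ennreal_leI) (auto simp: T_def indicator_def)
    finally show "\<forall>\<^sub>F k in sequentially. (\<integral>\<^sup>+x. (norm (f k x))\<^sup>2 \<partial>lborel) \<le> (\<integral>\<^sup>+\<xi>. (norm (F \<xi>))\<^sup>2 \<partial>lborel)"
      by simp
  qed measurable
  have f'_close: "(\<integral>\<^sup>+x. (norm (f k x - f' x))\<^sup>2 \<partial>lborel) \<le> ennreal (2 * (1 / 4) ^ k)" for k
  proof (rule Fatou_bound[where u = "\<lambda>m x. ennreal ((norm (f m x - f k x))\<^sup>2)"])
    show "AE x in lborel. (\<lambda>m. ennreal ((norm (f m x - f k x))\<^sup>2)) \<longlonglongrightarrow> ennreal ((norm (f k x - f' x))\<^sup>2)"
      using f_lim by (rule eventually_mono) (subst norm_minus_commute, intro tendsto_intros)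
    show "\<forall>\<^sub>F m in sequentially. (\<integral>\<^sup>+x. (norm (f m x - f k x))\<^sup>2 \<partial>lborel) \<le> ennreal (2 * (1 / 4) ^ k)"
      using close eventually_ge_at_top by (rule eventually_mono[rotated])
  qed measurable
  have f'2: "integrable lborel (\<lambda>x. (norm (f' x))\<^sup>2)"
    using bound F2_nn by (intro integrableI_bounded) (auto simp: norm_power intro: le_less_trans)
  show ?thesis
  proof (rule that)
    show "square_integrable f'" using f'2 by (simp add: square_integrable_def)
    have "(\<integral>\<^sup>+x. (norm (f' x))\<^sup>2 \<partial>lborel) = ennreal (LINT x|lborel. (norm (f' x))\<^sup>2)"
      using f'2 by (intro nn_integral_eq_integral) auto
    then show "L2norm f' \<le> L2norm F"
      using bound F2_nn by (simp add: L2norm_def)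
    fix \<phi> :: "'a \<Rightarrow> complex" assume "schwartz \<phi>"
    note \<phi> = schwartz_integrable[OF this]
    note [measurable] = borel_measurable_integrable[OF \<phi>(1)]
    have "(\<integral>\<^sup>+x. (norm (inv_fourier \<phi> x))\<^sup>2 \<partial>lborel) \<le> ennreal (LINT x|lborel. (norm (\<phi> x))\<^sup>2)"
      using Plancherel_le[OF \<phi>(1)] \<phi>(2) by (simp add: nn_integral_eq_integral)
    then have inv\<phi>: "integrable lborel (\<lambda>x. (norm (inv_fourier \<phi> x))\<^sup>2)"
      by (intro integrableI_bounded) (auto simp: norm_power intro: le_less_trans)
    have "(\<lambda>k. LINT \<xi>|lborel. T (R k) \<xi> * inv_fourier \<phi> \<xi>) \<longlonglongrightarrow> (LINT \<xi>|lborel. F \<xi> * inv_fourier \<phi> \<xi>)"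
    proof (rule integral_tendsto_of_L2_close)
      show "(\<integral>\<^sup>+\<xi>. (norm (T (R k) \<xi> - F \<xi>))\<^sup>2 \<partial>lborel) \<le> ennreal (2 * (1 / 4) ^ k)" for k
        using less_imp_le[OF R] by (rule order.trans) (simp add: ennreal_leI)
    qed (use F2 inv\<phi> in auto)
    moreover have "(\<lambda>k. LINT x|lborel. f k x * \<phi> x) \<longlonglongrightarrow> (LINT x|lborel. f' x * \<phi> x)"
      by (rule integral_tendsto_of_L2_close) (use f'_close f'2 \<phi> in auto)
    ultimately show "(LINT \<xi>|lborel. F \<xi> * inv_fourier \<phi> \<xi>) = (LINT x|lborel. f' x * \<phi> x)"
      unfolding f_def inv_fourier_mult_swap[OF T_int \<phi>(1)] by (rule LIMSEQ_unique)
  qed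
qed

section \<open>Estimates of Sobolev solutions\<close>

lemma hat_measurable:
  assumes "T \<in> Z_dual_fun"
  shows "hat T \<in> borel_measurable borel"
proof -
  have "has_fourier T (hat T)"
    using assms someI_ex[of "has_fourier T"] by (simp add: Z_dual_fun_def hat_def)
  then show ?thesis by (simp add: has_fourier_def)
qed

text \<open>By duality, a square integrable function on the Fourier side represents the distribution
  through its inverse transform, which is what allows norms of distributions to be estimated by
  integrals over frequencies.\<close>

lemma L2norm_distr_Dpow_le:
  assumes "square_integrable (\<lambda>\<xi>. norm \<xi> powr a *\<^sub>R hat T \<xi>)"
  shows "L2norm_distr (Dpow a T) \<le> ennreal (L2norm (\<lambda>\<xi>. norm \<xi> powr a *\<^sub>R hat T \<xi>))"
proof -
  obtain f where f: "square_integrable f" "L2norm f \<le> L2norm (\<lambda>\<xi>. norm \<xi> powr a *\<^sub>R hat T \<xi>)"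
    "\<And>\<phi>. schwartz \<phi> \<Longrightarrow>
      (LINT \<xi>|lborel. (norm \<xi> powr a *\<^sub>R hat T \<xi>) * inv_fourier \<phi> \<xi>) = (LINT x|lborel. f x * \<phi> x)"
    using square_integrable_inverse_transform[OF assms] by blast
  have "L2_representative (Dpow a T) f"
    using f(1,3) unfolding L2_representative_def Dpow_def Z_space_def by blast
  then have "L2norm_distr (Dpow a T) \<le> ennreal (L2norm f)"
    unfolding L2norm_distr_def by (intro INF_lower) simp
  also have "\<dots> \<le> ennreal (L2norm (\<lambda>\<xi>. norm \<xi> powr a *\<^sub>R hat T \<xi>))"
    by (intro ennreal_leI f(2))
  finally show ?thesis .
qed

text \<open>The factor 2 comes from \<open>(x + y)\<^sup>2 \<le> 2 (x\<^sup>2 + y\<^sup>2)\<close>, which stands in for Minkowski's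
  inequality.\<close>

lemma L2norm_dominated:
  fixes F A B :: "'a::euclidean_space \<Rightarrow> complex"
  assumes A: "square_integrable A" and B: "square_integrable B"
    and F: "F \<in> borel_measurable borel" and c: "c \<ge> 0"
    and le: "AE \<xi> in lborel. norm (F \<xi>) \<le> c * (norm (A \<xi>) + norm (B \<xi>))"
  shows "square_integrable F" and "L2norm F \<le> 2 * c * (L2norm A + L2norm B)"
proof -
  have A2: "integrable lborel (\<lambda>\<xi>. (norm (A \<xi>))\<^sup>2)" and B2: "integrable lborel (\<lambda>\<xi>. (norm (B \<xi>))\<^sup>2)"
    using A B by (auto simp: square_integrable_def)
  have le2: "AE \<xi> in lborel. (norm (F \<xi>))\<^sup>2 \<le> 2 * c\<^sup>2 * ((norm (A \<xi>))\<^sup>2 + (norm (B \<xi>))\<^sup>2)"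
    using le
  proof (rule eventually_mono)
    fix \<xi> assume "norm (F \<xi>) \<le> c * (norm (A \<xi>) + norm (B \<xi>))"
    then have "(norm (F \<xi>))\<^sup>2 \<le> (c * (norm (A \<xi>) + norm (B \<xi>)))\<^sup>2"
      by (intro power_mono) auto
    also have "\<dots> = c\<^sup>2 * (norm (A \<xi>) + norm (B \<xi>))\<^sup>2" by (rule power_mult_distrib)
    also have "\<dots> \<le> c\<^sup>2 * (2 * ((norm (A \<xi>))\<^sup>2 + (norm (B \<xi>))\<^sup>2))"
      using sum_squares_bound[of "norm (A \<xi>)" "norm (B \<xi>)"]
      by (intro mult_left_mono) (auto simp: power2_sum)
    finally show "(norm (F \<xi>))\<^sup>2 \<le> 2 * c\<^sup>2 * ((norm (A \<xi>))\<^sup>2 + (norm (B \<xi>))\<^sup>2)"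
      by (simp add: algebra_simps)
  qed
  have dom: "integrable lborel (\<lambda>\<xi>. 2 * c\<^sup>2 * ((norm (A \<xi>))\<^sup>2 + (norm (B \<xi>))\<^sup>2))"
    by (intro integrable_mult_right Bochner_Integration.integrable_add A2 B2)
  have F2: "integrable lborel (\<lambda>\<xi>. (norm (F \<xi>))\<^sup>2)"
  proof (rule Bochner_Integration.integrable_bound[OF dom])
    show "(\<lambda>\<xi>. (norm (F \<xi>))\<^sup>2) \<in> borel_measurable lborel" using F by simp
    show "AE \<xi> in lborel. norm ((norm (F \<xi>))\<^sup>2) \<le> norm (2 * c\<^sup>2 * ((norm (A \<xi>))\<^sup>2 + (norm (B \<xi>))\<^sup>2))"
      using le2 by (rule eventually_mono) (auto intro: order.trans[OF _ abs_ge_self])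
  qed
  then show "square_integrable F" using F by (simp add: square_integrable_def)
  have sq: "(L2norm H)\<^sup>2 = (LINT \<xi>|lborel. (norm (H \<xi>))\<^sup>2)" and nonneg: "L2norm H \<ge> 0" for H :: "'a \<Rightarrow> complex"
    by (auto simp: L2norm_def)
  have "(L2norm F)\<^sup>2 \<le> (LINT \<xi>|lborel. 2 * c\<^sup>2 * ((norm (A \<xi>))\<^sup>2 + (norm (B \<xi>))\<^sup>2))"
    unfolding sq by (intro integral_mono_AE F2 dom le2)
  also have "\<dots> = 2 * c\<^sup>2 * ((L2norm A)\<^sup>2 + (L2norm B)\<^sup>2)"
    using A2 B2 by (simp add: sq)
  also have "\<dots> \<le> (2 * c\<^sup>2 * ((L2norm A)\<^sup>2 + (L2norm B)\<^sup>2)) * 2 + 8 * c\<^sup>2 * (L2norm A * L2norm B)"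
    using nonneg by simp
  also have "\<dots> = (2 * c * (L2norm A + L2norm B))\<^sup>2"
    by (simp add: power2_eq_square algebra_simps)
  finally show "L2norm F \<le> 2 * c * (L2norm A + L2norm B)"
    by (rule power2_le_imp_le) (use c nonneg in auto)
qed

theorem theorem3p1:
  fixes b b' g g' g'' G :: "real \<Rightarrow> real" and \<beta> :: real
  defines "G \<equiv> half_primitive g"
  assumes g_deriv: "\<And>t. t \<ge> 0 \<Longrightarrow> (g has_real_derivative g' t) (at t within {0..})"
    and g'_deriv: "\<And>t. t \<ge> 0 \<Longrightarrow> (g' has_real_derivative g'' t) (at t within {0..})"
    and A1: "\<And>t. t \<ge> 0 \<Longrightarrow> g t > 0 \<and> g' t > 0"
    and A2: "set_integrable lborel {0..} (\<lambda>t. 1 / g t)"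
    and A3_1: "\<exists>C1>0. \<forall>t>0. \<bar>g' t\<bar> \<le> C1 * g t * (g t / G t)"
    and A3_2: "\<exists>C2>0. \<forall>t>0. \<bar>g'' t\<bar> \<le> C2 * g t * (g t / G t)\<^sup>2"
    and b_nonneg: "\<And>t. t \<ge> 0 \<Longrightarrow> b t \<ge> 0"
    and b_limsup: "Limsup at_top (\<lambda>t. ereal (t * b t)) < 1"
    and B1_deriv: "\<And>t. t \<ge> 0 \<Longrightarrow> (b has_real_derivative b' t) (at t within {0..})"
    and B1_cont: "continuous_on {0..} b'"
    and B2: "\<And>t. t \<ge> 0 \<Longrightarrow> b' t < 0"
    and B3: "\<exists>c>0. \<forall>t\<ge>0. (b t)\<^sup>2 \<le> c * (- b' t)"
    and N_EF: "\<exists>Ct>0. \<forall>t>0. b t \<le> Ct * (g t / G t)"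
    and \<beta>: "\<beta> \<ge> 2"
  shows "\<exists>C>0. \<forall>(u0 :: (real ^ 'n) distr) \<in> Hdot \<beta>. \<forall>u1 \<in> Hdot (\<beta> - 2). \<forall>u ut.
           sobolev_solution b g u0 u1 u ut \<longrightarrow>
           (\<forall>t\<ge>0.
              L2norm_distr (Dpow \<beta> (u t))
                \<le> ennreal (C * (Hdot_norm \<beta> u0 + Hdot_norm (\<beta> - 2) u1)) \<and>
              L2norm_distr (Dpow (\<beta> - 2) (ut t))
                \<le> ennreal (C * g t * (Hdot_norm \<beta> u0 + Hdot_norm (\<beta> - 2) u1)))"
proof -
  define K where "K = integral {0..} (\<lambda>t. 1 / g t)"
  define M where "M = exp K * (1 + 1 / g 0)"
  have g0: "g 0 > 0" using A1 by simp
  have M_pos: "M > 0" using g0 by (simp add: M_def add_pos_pos)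
  have K: "integral {0..t} (\<lambda>s. 1 / g s) \<le> K" if "t \<ge> 0" for t
    unfolding K_def
  proof (rule integral_subset_le)
    show "(\<lambda>s. 1 / g s) integrable_on {0..}" by (rule set_borel_integral_eq_integral(1)[OF A2])
    show "(\<lambda>s. 1 / g s) integrable_on {0..t}"
      by (rule set_borel_integral_eq_integral(1)[OF set_integrable_subset[OF A2]]) auto
    show "\<forall>s\<in>{0..}. 0 \<le> 1 / g s" using A1 by (auto simp: less_imp_le)
  qed auto
  have b_cont: "continuous_on {0..} b"
    using B1_deriv by (intro DERIV_continuous_on) auto
  show ?thesis
  proof (intro exI[of _ "2 * M"] conjI ballI allI impI)
    show "2 * M > 0" using M_pos by simp
    fix u0 u1 :: "(real ^ 'n) distr" and u ut and t :: real
    assume u0: "u0 \<in> Hdot \<beta>" and u1: "u1 \<in> Hdot (\<beta> - 2)"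
      and sol: "sobolev_solution b g u0 u1 u ut" and t: "t \<ge> 0"
    let ?A = "\<lambda>\<xi>. norm \<xi> powr \<beta> *\<^sub>R hat u0 \<xi>"
    let ?B = "\<lambda>\<xi>. norm \<xi> powr (\<beta> - 2) *\<^sub>R hat u1 \<xi>"
    let ?F = "\<lambda>\<xi>. norm \<xi> powr \<beta> *\<^sub>R hat (u t) \<xi>"
    let ?F' = "\<lambda>\<xi>. norm \<xi> powr (\<beta> - 2) *\<^sub>R hat (ut t) \<xi>"
    have A: "square_integrable ?A" and B: "square_integrable ?B"
      using u0 u1 by (auto simp: Hdot_def)
    have norms: "Hdot_norm \<beta> u0 = L2norm ?A" "Hdot_norm (\<beta> - 2) u1 = L2norm ?B"
      by (simp_all add: Hdot_norm_def)
    have [measurable]: "hat (u t) \<in> borel_measurable borel" "hat (ut t) \<in> borel_measurable borel"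
      using sol t by (auto simp: sobolev_solution_def intro!: hat_measurable)
    obtain w v where
      wv: "AE \<xi> in lborel. w t \<xi> = hat (u t) \<xi> \<and> v t \<xi> = hat (ut t) \<xi>"
      and ode: "AE \<xi> in lborel. w 0 \<xi> = hat u0 \<xi> \<and> v 0 \<xi> = hat u1 \<xi> \<and>
           fourier_ode b g (norm \<xi>) (\<lambda>t. w t \<xi>) (\<lambda>t. v t \<xi>)"
      using sol t unfolding sobolev_solution_def by blast
    \<comment> \<open>The frequency \<open>0\<close>, where the oscillator degenerates, is a null set.\<close>
    have "AE \<xi> in lborel. norm (?F \<xi>) \<le> M * (norm (?A \<xi>) + norm (?B \<xi>)) \<and>
        norm (?F' \<xi>) \<le> M * g t * (norm (?A \<xi>) + norm (?B \<xi>))"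
      using wv ode AE_lborel_singleton[of "0 :: real ^ 'n"]
    proof eventually_elim
      case (elim \<xi>)
      define r where "r = norm \<xi>"
      have r: "r > 0" using elim by (simp add: r_def)
      \<comment> \<open>The common majorant from the oscillator bound; \<open>r powr \<beta>\<close> times it is controlled by
        the two data because \<open>r powr \<beta> / r\<^sup>2\<close> is the weight \<open>r powr (\<beta> - 2)\<close> of the second one.\<close>
      define D where "D = exp K * (norm (hat u0 \<xi>) + norm (hat u1 \<xi>) / (r\<^sup>2 * g 0))"
      have est: "norm (hat (u t) \<xi>) \<le> D" "norm (hat (ut t) \<xi>) \<le> r\<^sup>2 * g t * D"
        using overdamped_oscillator_bound[of b g r "\<lambda>t. w t \<xi>" "\<lambda>t. v t \<xi>" g' K t]
          elim r g_deriv A1 b_cont b_nonneg K t by (auto simp: r_def D_def less_imp_le)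
      have split: "r powr \<beta> = r\<^sup>2 * r powr (\<beta> - 2)"
        using r by (simp add: powr_diff powr_numeral)
      have "r powr \<beta> * D = exp K * (norm (?A \<xi>) + 1 / g 0 * norm (?B \<xi>))"
        using r g0 by (simp add: D_def split field_simps flip: r_def)
      also have "\<dots> \<le> exp K * ((1 + 1 / g 0) * norm (?A \<xi>) + (1 + 1 / g 0) * norm (?B \<xi>))"
        using g0 by (intro mult_left_mono add_mono mult_right_mono) (auto simp: field_simps)
      also have "\<dots> = M * (norm (?A \<xi>) + norm (?B \<xi>))"
        by (simp add: M_def algebra_simps)
      finally have D: "r powr \<beta> * D \<le> M * (norm (?A \<xi>) + norm (?B \<xi>))" .
      have "norm (?F \<xi>) = r powr \<beta> * norm (hat (u t) \<xi>)" by (simp add: r_def)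
      also have "\<dots> \<le> r powr \<beta> * D" using est(1) by (intro mult_left_mono) auto
      finally have F: "norm (?F \<xi>) \<le> r powr \<beta> * D" .
      have "norm (?F' \<xi>) = r powr (\<beta> - 2) * norm (hat (ut t) \<xi>)" by (simp add: r_def)
      also have "\<dots> \<le> r powr (\<beta> - 2) * (r\<^sup>2 * g t * D)" using est(2) by (intro mult_left_mono) auto
      also have "\<dots> = g t * (r powr \<beta> * D)" by (simp add: split)
      also have "\<dots> \<le> g t * (M * (norm (?A \<xi>) + norm (?B \<xi>)))"
        using A1[OF t] D by (intro mult_left_mono) auto
      also have "\<dots> = M * g t * (norm (?A \<xi>) + norm (?B \<xi>))" by (simp only: mult_ac)
      finally show ?case using order.trans[OF F D] by blast
    qed
    then have le: "AE \<xi> in lborel. norm (?F \<xi>) \<le> M * (norm (?A \<xi>) + norm (?B \<xi>))"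
      and le': "AE \<xi> in lborel. norm (?F' \<xi>) \<le> M * g t * (norm (?A \<xi>) + norm (?B \<xi>))"
      by auto
    have F: "square_integrable ?F" "L2norm ?F \<le> 2 * M * (L2norm ?A + L2norm ?B)"
      using M_pos by (intro L2norm_dominated[OF A B _ _ le]; simp)+
    have F': "square_integrable ?F'" "L2norm ?F' \<le> 2 * (M * g t) * (L2norm ?A + L2norm ?B)"
      using M_pos A1[OF t] by (intro L2norm_dominated[OF A B _ _ le']; simp)+
    show "L2norm_distr (Dpow \<beta> (u t)) \<le> ennreal (2 * M * (Hdot_norm \<beta> u0 + Hdot_norm (\<beta> - 2) u1))"
      unfolding norms by (rule order.trans[OF L2norm_distr_Dpow_le[OF F(1)] ennreal_leI[OF F(2)]])
    show "L2norm_distr (Dpow (\<beta> - 2) (ut t))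
        \<le> ennreal (2 * M * g t * (Hdot_norm \<beta> u0 + Hdot_norm (\<beta> - 2) u1))"
      using order.trans[OF L2norm_distr_Dpow_le[OF F'(1)] ennreal_leI[OF F'(2)]]
      unfolding norms by (simp only: mult.assoc)
  qed
qed

end
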